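(* Let $f:X\to\mathbb{R}$ be Lipschitz with $f>0$. (1) Every weak* accumulation point of $\mu_{c,s}$ as $c\to\infty$ and $s\to1$ belongs to $M_{max}(f)$. (2) If $g:X\to\mathbb{R}$ is continuous and $c_j\to\infty$, $s_j\to 1$ ($c_j>0$, $s_j\in(0,1)$) are sequences such that $\lim_{j\to\infty}\int g\,d\mu_{c_j,s_j}$ exists, then this limit equals $\int g\,d\mu$ for some weak* accumulation point $\mu$ of $\mu_{c,s}$ (as $c\to\infty$, $s\to1$). (3) In particular, if $M_{max}(f)=\{\mu_\infty\}$ is a singleton, then for every continuous $g:X\to\mathbb{R}$, $$\lim_{c\to\infty,\,s\to1}\int g\,d\mu_{c,s}=\int g\,d\mu_\infty .$$
   Context: $X=\{1,\dots,d\}^{\mathbb{N}}$ is the full Bernoulli space with shift $\sigma$ and metric $d(x,y)=\theta^{N}$, where $N$ is the first index with $x_N\ne y_N$ (and $d(x,x)=0$), $0<\theta<1$ fixed. Lipschitz is with respect to this metric. For $g:X\to\mathbb{R}$, $g^n(x)=g(x)+g(\sigma x)+\dots+g(\sigma^{n-1}x)$. $\mathrm{Fix}_n=\{x:\sigma^n(x)=x\}$. $P(\cdot)$ is topological pressure for $\sigma$. $\mathcal{M}$ is the set of $\sigma$-invariant Borel probabilities, $\beta(f)=\sup_{\nu\in\mathcal{M}}\int f\,d\nu$ and $M_{max}(f)=\{\nu\in\mathcal{M}:\int f\,d\nu=\beta(f)\}$. For $c>0$, $s\in(0,1)$, $\mu_{c,s}\in\mathcal{M}$ is given by $$\int g\,d\mu_{c,s}=\frac{\sum_{n=1}^{\infty}\sum_{x\in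 \mathrm{Fix}_{n}}e^{c s f^{n}(x)-nP(cf)}\frac{g^{n}(x)}{n}}{\sum_{n=1}^{\infty}\sum_{x\in \mathrm{Fix}_{n}}e^{c s f^{n}(x)-nP(cf)}}$$ for continuous $g$ (the series converge since $P(csf-P(cf))<0$). An accumulation point of $\mu_{c,s}$ as $c\to\infty$, $s\to1$ is a weak* limit of $\mu_{c_j,s_j}$ for some sequences $c_j\to\infty$, $s_j\to1$. *)

theory Defs
  imports "HOL-Probability.Probability"
begin

section \<open>The full shift\<close>

definition full_shift :: "nat \<Rightarrow> (nat \<Rightarrow> nat) set" where
  "full_shift d = {x. \<forall>i. x i \<in> {1..d}}"

definition shift :: "(nat \<Rightarrow> nat) \<Rightarrow> nat \<Rightarrow> nat" where
  "shift x = (\<lambda>i. x (Suc i))"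

text \<open>Coordinates are numbered from 0. Numbering them from 1 would multiply the metric by the
  constant \<open>\<theta>\<close>, which affects neither the Lipschitz functions nor the pressure.\<close>

definition theta_dist :: "real \<Rightarrow> (nat \<Rightarrow> nat) \<Rightarrow> (nat \<Rightarrow> nat) \<Rightarrow> real" where
  "theta_dist \<theta> x y = (if x = y then 0 else \<theta> ^ (LEAST N. x N \<noteq> y N))"

definition shift_metric :: "nat \<Rightarrow> real \<Rightarrow> (nat \<Rightarrow> nat) metric" where
  "shift_metric d \<theta> = metric (full_shift d, theta_dist \<theta>)"

lemma theta_dist_less_iff:
  assumes "0 < \<theta>" "\<theta> < 1"
  shows "theta_dist \<theta> x y < \<theta> ^ k \<longleftrightarrow> (\<forall>i\<le>k. x i = y i)"
proof (cases "x = y")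
  case True
  then show ?thesis using assms by (simp add: theta_dist_def)
next
  case False
  then obtain n where n: "x n \<noteq> y n" by auto
  define N where "N = (LEAST N. x N \<noteq> y N)"
  have N: "x N \<noteq> y N" unfolding N_def by (rule LeastI[of _ n]) (rule n)
  have below: "x i = y i" if "i < N" for i
    using not_less_Least[OF that[unfolded N_def]] by simp
  have "theta_dist \<theta> x y < \<theta> ^ k \<longleftrightarrow> \<theta> ^ N < \<theta> ^ k"
    using False by (simp add: theta_dist_def N_def)
  also have "\<dots> \<longleftrightarrow> k < N"
    using assms by (simp add: power_strict_decreasing_iff)
  also have "\<dots> \<longleftrightarrow> (\<forall>i\<le>k. x i = y i)"
    using N below by (metis le_less_trans not_le)
  finally show ?thesis .
qed

lemma Metric_space_theta_dist:
  assumes "0 < \<theta>" "\<theta> < 1"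
  shows "Metric_space (full_shift d) (theta_dist \<theta>)"
proof
  fix x y z :: "nat \<Rightarrow> nat"
  show nonneg: "0 \<le> theta_dist \<theta> x y" for x y
    using assms by (simp add: theta_dist_def)
  show "theta_dist \<theta> x y = theta_dist \<theta> y x"
    by (simp add: theta_dist_def eq_commute)
  show "theta_dist \<theta> x y = 0 \<longleftrightarrow> x = y"
    using assms by (simp add: theta_dist_def)
  show "theta_dist \<theta> x z \<le> theta_dist \<theta> x y + theta_dist \<theta> y z"
  proof (cases "x = z")
    case True
    then show ?thesis using nonneg by (simp add: theta_dist_def[of _ z z])
  next
    case False
    define N where "N = (LEAST N. x N \<noteq> z N)"
    have xz: "theta_dist \<theta> x z = \<theta> ^ N"
      using False by (simp add: theta_dist_def N_def)
    have "\<not> (theta_dist \<theta> x y < \<theta> ^ N \<and> theta_dist \<theta> y z < \<theta> ^ N)"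
      using theta_dist_less_iff[OF assms] xz by (metis order.irrefl)
    then show ?thesis
      using nonneg[of x y] nonneg[of y z] xz by linarith
  qed
qed

text \<open>The metric induces the product topology, so that continuity and Borel sets may be expressed
  through the topology of the function type.\<close>

lemma mtopology_of_shift_metric:
  assumes "0 < \<theta>" "\<theta> < 1"
  shows "mtopology_of (shift_metric d \<theta>) = top_of_set (full_shift d)"
proof -
  interpret Metric_space "full_shift d" "theta_dist \<theta>"
    by (rule Metric_space_theta_dist[OF assms])
  have "openin mtopology U \<longleftrightarrow> openin (top_of_set (full_shift d)) U" for U
  proof
    assume U: "openin mtopology U"
    show "openin (top_of_set (full_shift d)) U"
    proof (subst openin_subopen, intro ballI)
      fix x assume x: "x \<in> U"
      obtain r where r: "r > 0" "mball x r \<subseteq> U"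
        using U x by (auto simp: openin_mtopology)
      have xX: "x \<in> full_shift d"
        using U x by (auto simp: openin_mtopology)
      obtain k where k: "\<theta> ^ k < r"
        using real_arch_pow_inv[OF r(1) assms(2)] by auto
      define V where "V = full_shift d \<inter> (\<Pi>\<^sub>E i\<in>UNIV. if i \<le> k then {x i} else UNIV)"
      have "open (\<Pi>\<^sub>E i\<in>UNIV. if i \<le> k then {x i} else (UNIV :: nat set))"
      proof (rule open_PiE)
        show "open (if i \<le> k then {x i} else (UNIV :: nat set))" for i
          by (rule discrete_topology_class.open_discrete)
        show "finite {i. (if i \<le> k then {x i} else UNIV) \<noteq> UNIV}"
          by (rule finite_subset[of _ "{..k}"]) auto
      qed
      then have "openin (top_of_set (full_shift d)) V"
        unfolding V_def by blast
      moreover have "x \<in> V"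
        using xX by (auto simp: V_def)
      moreover have "V \<subseteq> U"
      proof
        fix y assume y: "y \<in> V"
        have "x i = y i" if "i \<le> k" for i
        proof -
          have "y i \<in> (if i \<le> k then {x i} else UNIV)"
            using y unfolding V_def by (blast dest: PiE_mem)
          then show ?thesis using that by simp
        qed
        then have "theta_dist \<theta> x y < \<theta> ^ k"
          using theta_dist_less_iff[OF assms] by blast
        then have "y \<in> mball x r"
          using y k xX by (simp add: V_def)
        then show "y \<in> U" using r by blast
      qed
      ultimately show "\<exists>T. openin (top_of_set (full_shift d)) T \<and> x \<in> T \<and> T \<subseteq> U" by blast
    qed
  next
    assume "openin (top_of_set (full_shift d)) U"
    then obtain T where T: "open T" "U = full_shift d \<inter> T"
      by (auto simp: openin_open)
    show "openin mtopology U"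
      unfolding openin_mtopology
    proof (intro conjI allI impI)
      show "U \<subseteq> full_shift d" using T by blast
    next
      fix x assume x: "x \<in> U"
      have "openin (product_topology (\<lambda>i. euclidean) UNIV) T"
        using T(1) by (simp add: open_fun_def)
      then obtain W where W: "x \<in> (\<Pi>\<^sub>E i\<in>UNIV. W i)" "finite {i::nat. W i \<noteq> (UNIV::nat set)}"
        "(\<Pi>\<^sub>E i\<in>UNIV. W i) \<subseteq> T"
        using product_topology_open_contains_basis[of "\<lambda>i. euclidean" UNIV T x] x T(2) by auto
      obtain k where k: "{i. W i \<noteq> UNIV} \<subseteq> {..k}"
        using W(2) finite_nat_iff_bounded_le by blast
      have "mball x (\<theta> ^ k) \<subseteq> U"
      proof
        fix y assume y: "y \<in> mball x (\<theta> ^ k)"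
        then have eq: "\<forall>i\<le>k. x i = y i"
          using theta_dist_less_iff[OF assms] by simp
        have "y i \<in> W i" for i
        proof (cases "i \<le> k")
          case True
          then show ?thesis using eq PiE_mem[OF W(1), of i] by simp
        next
          case False
          then show ?thesis using k by auto
        qed
        then have "y \<in> T" using W(3) by auto
        then show "y \<in> U" using y T(2) by simp
      qed
      then show "\<exists>r>0. mball x r \<subseteq> U"
        using assms(1) zero_less_power by blast
    qed
  qed
  then show ?thesis
    by (simp add: topology_eq mtopology_of_def shift_metric_def)
qed


section \<open>Birkhoff sums and topological pressure\<close>

definition birkhoff_sum :: "('a \<Rightarrow> 'a) \<Rightarrow> ('a \<Rightarrow> real) \<Rightarrow> nat \<Rightarrow> 'a \<Rightarrow> real" where
  "birkhoff_sum T g n x = (\<Sum>i<n. g ((T ^^ i) x))"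

text \<open>Topological pressure by \<open>(n, \<epsilon>)\<close>-separated sets. In a compact space separated sets are
  automatically finite, so requiring finiteness is no restriction there.\<close>

definition dyn_separated :: "'a metric \<Rightarrow> ('a \<Rightarrow> 'a) \<Rightarrow> nat \<Rightarrow> real \<Rightarrow> 'a set \<Rightarrow> bool" where
  "dyn_separated m T n \<epsilon> E \<longleftrightarrow> E \<subseteq> mspace m \<and> finite E \<and>
     (\<forall>x\<in>E. \<forall>y\<in>E. x \<noteq> y \<longrightarrow> (\<exists>i<n. mdist m ((T ^^ i) x) ((T ^^ i) y) > \<epsilon>))"

definition partition_sum ::
  "'a metric \<Rightarrow> ('a \<Rightarrow> 'a) \<Rightarrow> ('a \<Rightarrow> real) \<Rightarrow> nat \<Rightarrow> real \<Rightarrow> real" where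
  "partition_sum m T \<phi> n \<epsilon> =
     (SUP E \<in> {E. dyn_separated m T n \<epsilon> E}. \<Sum>x\<in>E. exp (birkhoff_sum T \<phi> n x))"

definition top_pressure :: "'a metric \<Rightarrow> ('a \<Rightarrow> 'a) \<Rightarrow> ('a \<Rightarrow> real) \<Rightarrow> ereal" where
  "top_pressure m T \<phi> =
     Lim (at_right 0) (\<lambda>\<epsilon>. limsup (\<lambda>n. ereal (ln (partition_sum m T \<phi> n \<epsilon>) / real n)))"

text \<open>For continuous potentials on the full shift over a nonempty alphabet the pressure is finite.\<close>

definition pressure :: "nat \<Rightarrow> real \<Rightarrow> ((nat \<Rightarrow> nat) \<Rightarrow> real) \<Rightarrow> real" where
  "pressure d \<theta> \<phi> = real_of_ereal (top_pressure (shift_metric d \<theta>) shift \<phi>)"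


section \<open>Invariant and maximizing measures\<close>

definition prob_measures :: "nat \<Rightarrow> (nat \<Rightarrow> nat) measure set" where
  "prob_measures d = {\<nu>. prob_space \<nu> \<and> sets \<nu> = sets (restrict_space borel (full_shift d))}"

definition invariant_measures :: "nat \<Rightarrow> (nat \<Rightarrow> nat) measure set" where
  "invariant_measures d = {\<nu> \<in> prob_measures d. distr \<nu> \<nu> shift = \<nu>}"

definition max_value :: "nat \<Rightarrow> ((nat \<Rightarrow> nat) \<Rightarrow> real) \<Rightarrow> real" where
  "max_value d f = (SUP \<nu> \<in> invariant_measures d. \<integral>x. f x \<partial>\<nu>)"

definition max_measures :: "nat \<Rightarrow> ((nat \<Rightarrow> nat) \<Rightarrow> real) \<Rightarrow> (nat \<Rightarrow> nat) measure set" where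
  "max_measures d f = {\<nu> \<in> invariant_measures d. (\<integral>x. f x \<partial>\<nu>) = max_value d f}"


section \<open>The measures built from periodic points\<close>

definition Fix :: "nat \<Rightarrow> nat \<Rightarrow> (nat \<Rightarrow> nat) set" where
  "Fix d n = {x \<in> full_shift d. (shift ^^ n) x = x}"

definition periodic_weight ::
  "nat \<Rightarrow> real \<Rightarrow> ((nat \<Rightarrow> nat) \<Rightarrow> real) \<Rightarrow> real \<Rightarrow> real \<Rightarrow> nat \<Rightarrow> (nat \<Rightarrow> nat) \<Rightarrow> real" where
  "periodic_weight d \<theta> f c s n x =
     exp (c * s * birkhoff_sum shift f n x - real n * pressure d \<theta> (\<lambda>y. c * f y))"

text \<open>The sums over \<open>n \<ge> 1\<close> are written with the index \<open>Suc n\<close>.\<close>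

definition periodic_average ::
  "nat \<Rightarrow> real \<Rightarrow> ((nat \<Rightarrow> nat) \<Rightarrow> real) \<Rightarrow> real \<Rightarrow> real \<Rightarrow> ((nat \<Rightarrow> nat) \<Rightarrow> real) \<Rightarrow> real" where
  "periodic_average d \<theta> f c s g =
     (\<Sum>n. \<Sum>x\<in>Fix d (Suc n).
        periodic_weight d \<theta> f c s (Suc n) x * (birkhoff_sum shift g (Suc n) x / real (Suc n))) /
     (\<Sum>n. \<Sum>x\<in>Fix d (Suc n). periodic_weight d \<theta> f c s (Suc n) x)"

definition periodic_measure ::
  "nat \<Rightarrow> real \<Rightarrow> ((nat \<Rightarrow> nat) \<Rightarrow> real) \<Rightarrow> real \<Rightarrow> real \<Rightarrow> (nat \<Rightarrow> nat) measure" where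
  "periodic_measure d \<theta> f c s =
     (THE \<nu>. \<nu> \<in> invariant_measures d \<and>
        (\<forall>g. continuous_on (full_shift d) g \<longrightarrow> (\<integral>x. g x \<partial>\<nu>) = periodic_average d \<theta> f c s g))"

definition weak_star_limit ::
  "nat \<Rightarrow> (nat \<Rightarrow> (nat \<Rightarrow> nat) measure) \<Rightarrow> (nat \<Rightarrow> nat) measure \<Rightarrow> bool" where
  "weak_star_limit d \<nu> \<mu> \<longleftrightarrow> \<mu> \<in> prob_measures d \<and>
     (\<forall>g :: (nat \<Rightarrow> nat) \<Rightarrow> real. continuous_on (full_shift d) g \<longrightarrow>
        (\<lambda>j. \<integral>x. g x \<partial>\<nu> j) \<longlonglongrightarrow> (\<integral>x. g x \<partial>\<mu>))"

definition admissible_seqs :: "(nat \<Rightarrow> real) \<Rightarrow> (nat \<Rightarrow> real) \<Rightarrow> bool" where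
  "admissible_seqs c s \<longleftrightarrow> (\<forall>j. c j > 0) \<and> (\<forall>j. s j \<in> {0<..<1}) \<and>
     filterlim c at_top sequentially \<and> s \<longlonglongrightarrow> 1"

definition accumulation_point ::
  "nat \<Rightarrow> real \<Rightarrow> ((nat \<Rightarrow> nat) \<Rightarrow> real) \<Rightarrow> (nat \<Rightarrow> nat) measure \<Rightarrow> bool" where
  "accumulation_point d \<theta> f \<mu> \<longleftrightarrow>
     (\<exists>c s. admissible_seqs c s \<and> weak_star_limit d (\<lambda>j. periodic_measure d \<theta> f (c j) (s j)) \<mu>)"

end

(* Write beta for the maximal value of f on invariant measures, S_n for Birkhoff sums and P for the
   pressure of c f, so that c beta <= P <= c beta + ln d. A point x of Fix_n with
   S_n x <= n (beta - eps) has weight at most exp(- n c s eps), and there are at most d^n of them, so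
   their total weight is O(exp(- c s eps)).

   The total weight of all periodic points has to be larger. A closing argument with the pigeonhole
   principle gives, for every eta > 0, a periodic point p of some period N with
   S_N p >= N beta - eta; its weight is at least exp(- c s eta - c (1 - s) N beta - N ln d), which
   wins once eta < eps, s is close to 1 and c is large. It matters that eta bounds the defect of the
   whole orbit sum: N depends on eta, so an orbit average within eta of beta would not suffice.

   Hence the integrals of f tend to beta, and the theorem follows by weak* compactness. Compactness
   is reduced to Helly's selection theorem by embedding the shift space into the real line. *)
theory Submission
  imports Defs
begin

section \<open>Borel probability measures on the full shift\<close>

text \<open>The Lipschitz condition enters through a distortion bound that does not depend on the
  length of the orbit segment. It gives \<open>S n x \<le> n * \<beta> + B / (1 - \<theta>)\<close>
  at every point, not only at periodic ones, so a segment whose total is at least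
  \<open>n * \<beta>\<close> stays in a window known in advance. The number of pigeonholes is
  therefore fixed before the segment is chosen, and the defect of a whole closed orbit can be made
  as small as desired.

  Besides its two bounds, the pressure has to control the growth of the sums of
  \<open>exp (c * S n x)\<close> over periodic points, since otherwise the series defining the
  measures might diverge. Positivity of \<open>f\<close> then has three uses: its minimum turns
  \<open>s < 1\<close> into exponential decay of the series, \<open>\<beta> \<ge> 0\<close> gives
  the factor \<open>s\<close> a known direction in estimates, and \<open>S n x \<ge> 0\<close>
  bounds the defect of an orbit average by \<open>\<beta>\<close>.

  The measures are given only by integrals of continuous functions. Their existence, their
  uniqueness and the invariance of their limits thus need a representation of such functionals, for
  which the same weak* compactness result serves.\<close>

abbreviation shift_borel :: "nat \<Rightarrow> (nat \<Rightarrow> nat) measure" where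
  "shift_borel d \<equiv> restrict_space borel (full_shift d)"

lemma funpow_shift: "(shift ^^ n) x i = x (n + i)"
  by (induction n arbitrary: i) (simp_all add: shift_def)

lemma shift_in_full_shift: "x \<in> full_shift d \<Longrightarrow> shift x \<in> full_shift d"
  by (simp add: full_shift_def shift_def)

lemma funpow_shift_in_full_shift: "x \<in> full_shift d \<Longrightarrow> (shift ^^ n) x \<in> full_shift d"
  by (simp add: full_shift_def funpow_shift)

lemma continuous_on_shift: "continuous_on A shift"
  unfolding shift_def
  by (intro continuous_on_coordinatewise_then_product
      continuous_on_subset[OF continuous_on_product_coordinates subset_UNIV])

lemma compact_full_shift: "compact (full_shift d)"
proof -
  have "full_shift d = (\<Pi>\<^sub>E i\<in>UNIV. {1..d})"
    by (auto simp: full_shift_def PiE_def)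
  moreover have "compactin (product_topology (\<lambda>i. euclidean) UNIV) (\<Pi>\<^sub>E i\<in>UNIV. {1..d})"
    unfolding compactin_PiE by (simp add: compactin_euclidean_iff finite_imp_compact)
  ultimately show ?thesis
    by (simp add: euclidean_product_topology compactin_euclidean_iff)
qed

lemma space_shift_borel: "space (shift_borel d) = full_shift d"
  by (simp add: space_restrict_space)

lemma prob_measures_space: "\<nu> \<in> prob_measures d \<Longrightarrow> space \<nu> = full_shift d"
  unfolding prob_measures_def using sets_eq_imp_space_eq space_shift_borel by blast

lemma prob_measures_measurable:
  fixes g :: "(nat \<Rightarrow> nat) \<Rightarrow> 'b::topological_space"
  assumes "\<nu> \<in> prob_measures d" "continuous_on (full_shift d) g"
  shows "g \<in> borel_measurable \<nu>"
proof -
  have "sets \<nu> = sets (shift_borel d)"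
    using assms(1) by (simp add: prob_measures_def)
  then show ?thesis
    using borel_measurable_continuous_on_restrict[OF assms(2)] by (simp cong: measurable_cong_sets)
qed

lemma continuous_on_full_shift_bounded:
  fixes g :: "(nat \<Rightarrow> nat) \<Rightarrow> real"
  assumes "continuous_on (full_shift d) g"
  obtains B where "B > 0" "\<And>x. x \<in> full_shift d \<Longrightarrow> \<bar>g x\<bar> \<le> B"
proof -
  have "bounded (g ` full_shift d)"
    using compact_continuous_image[OF assms compact_full_shift] by (rule compact_imp_bounded)
  then show thesis
    using that unfolding bounded_pos by auto
qed

lemma prob_measures_integrable:
  fixes g :: "(nat \<Rightarrow> nat) \<Rightarrow> real"
  assumes \<nu>: "\<nu> \<in> prob_measures d" and g: "continuous_on (full_shift d) g"
  shows "integrable \<nu> g"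
proof -
  interpret prob_space \<nu>
    using \<nu> by (simp add: prob_measures_def)
  obtain B where "\<And>x. x \<in> full_shift d \<Longrightarrow> \<bar>g x\<bar> \<le> B"
    using continuous_on_full_shift_bounded[OF g] by metis
  then show ?thesis
    using prob_measures_measurable[OF \<nu> g] prob_measures_space[OF \<nu>]
    by (intro integrable_const_bound[where B = B]) (auto intro!: AE_I2)
qed

text \<open>The base-\<open>(d+1)\<close> expansion embeds the full shift over \<open>d\<close> symbols into the real line, which
  makes uniqueness and compactness theorems for distributions on the line available.\<close>

definition digit_code :: "nat \<Rightarrow> (nat \<Rightarrow> nat) \<Rightarrow> real" where
  "digit_code d x = (\<Sum>n. real (x n) * (1 / (real d + 1)) ^ n)"

lemma digit_code_summable:
  assumes "d \<ge> 1" "x \<in> full_shift d"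
  shows "summable (\<lambda>n. real (x n) * (1 / (real d + 1)) ^ n)"
proof (rule summable_comparison_test')
  show "summable (\<lambda>n. real d * (1 / (real d + 1)) ^ n)"
    using assms by (intro summable_mult summable_geometric) auto
  show "norm (real (x n) * (1 / (real d + 1)) ^ n) \<le> real d * (1 / (real d + 1)) ^ n" for n
    using assms by (auto simp: full_shift_def intro!: mult_right_mono)
qed

lemma digit_code_bounds:
  assumes "d \<ge> 1" "x \<in> full_shift d"
  shows "(real d + 1) / real d \<le> digit_code d x" "digit_code d x \<le> real d + 1"
proof -
  have geo: "(\<lambda>n. a * (1 / (real d + 1)) ^ n) sums (a * ((real d + 1) / real d))" for a
    using sums_mult[OF geometric_sums[of "1 / (real d + 1)"], of a] assms(1)
    by (simp add: field_simps)
  have code: "(\<lambda>n. real (x n) * (1 / (real d + 1)) ^ n) sums digit_code d x"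
    unfolding digit_code_def using digit_code_summable[OF assms] by (rule summable_sums)
  have x: "1 \<le> x n" "x n \<le> d" for n
    using assms(2) by (auto simp: full_shift_def)
  show "(real d + 1) / real d \<le> digit_code d x"
    using sums_le[OF _ geo[of 1] code] x(1) by (simp add: mult_right_mono)
  show "digit_code d x \<le> real d + 1"
    using sums_le[OF _ code geo[of "real d"]] x(2) assms(1) by (simp add: mult_right_mono)
qed

lemma digit_code_shift:
  assumes "d \<ge> 1" "x \<in> full_shift d"
  shows "digit_code d x = real (x 0) + digit_code d (shift x) / (real d + 1)"
proof -
  have "digit_code d x = real (x 0) + (\<Sum>n. real (x (Suc n)) * (1 / (real d + 1)) ^ Suc n)"
    unfolding digit_code_def using suminf_split_head[OF digit_code_summable[OF assms]] by simp
  also have "(\<Sum>n. real (x (Suc n)) * (1 / (real d + 1)) ^ Suc n) =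
      (\<Sum>n. real (shift x n) * (1 / (real d + 1)) ^ n / (real d + 1))"
    by (simp add: shift_def field_simps)
  also have "\<dots> = digit_code d (shift x) / (real d + 1)"
    unfolding digit_code_def
    by (rule suminf_divide[OF digit_code_summable[OF assms(1) shift_in_full_shift[OF assms(2)]]])
  finally show ?thesis .
qed

text \<open>The codes of the tails lie in an interval of length less than \<open>d + 1\<close>;
  divided by \<open>d + 1\<close>, they cannot compensate for two different integer leading digits.
  In base \<open>d\<close> with \<open>d > 1\<close> the bound would be 1 itself, which allows the
  usual double expansions.\<close>

lemma digit_code_eqD:
  assumes d: "d \<ge> 1" and x: "x \<in> full_shift d" and y: "y \<in> full_shift d"
    and eq: "digit_code d x = digit_code d y"
  shows "x 0 = y 0" "digit_code d (shift x) = digit_code d (shift y)"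
proof -
  let ?c = "\<lambda>z. digit_code d (shift z)"
  have diff: "real (x 0) - real (y 0) = (?c y - ?c x) / (real d + 1)"
    using eq digit_code_shift[OF d x] digit_code_shift[OF d y] by (simp add: diff_divide_distrib)
  have pos: "(real d + 1) / real d > 0"
    using d by simp
  have "\<bar>?c y - ?c x\<bar> < real d + 1"
    using digit_code_bounds[OF d shift_in_full_shift[OF x]]
      digit_code_bounds[OF d shift_in_full_shift[OF y]] pos by linarith
  then have "\<bar>real (x 0) - real (y 0)\<bar> < 1"
    unfolding diff by (simp add: abs_divide)
  then show "x 0 = y 0"
    by linarith
  then show "?c x = ?c y"
    using diff by simp
qed

lemma inj_on_digit_code:
  assumes d: "d \<ge> 1"
  shows "inj_on (digit_code d) (full_shift d)"
proof
  fix x y assume xy: "x \<in> full_shift d" "y \<in> full_shift d" "digit_code d x = digit_code d y"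
  have "x n = y n" for n
    using xy
  proof (induction n arbitrary: x y)
    case 0
    then show ?case using digit_code_eqD(1)[OF d] by blast
  next
    case (Suc n)
    then have "shift x n = shift y n"
      using digit_code_eqD(2)[OF d] shift_in_full_shift by blast
    then show ?case by (simp add: shift_def)
  qed
  then show "x = y" by blast
qed

lemma continuous_on_digit_code:
  assumes d: "d \<ge> 1"
  shows "continuous_on (full_shift d) (digit_code d)"
proof (rule uniform_limit_theorem)
  show "uniform_limit (full_shift d)
      (\<lambda>n x. \<Sum>i<n. real (x i) * (1 / (real d + 1)) ^ i) (digit_code d) sequentially"
    unfolding digit_code_def
  proof (rule Weierstrass_m_test)
    show "summable (\<lambda>n. real d * (1 / (real d + 1)) ^ n)"
      using d by (intro summable_mult summable_geometric) auto
    show "norm (real (x n) * (1 / (real d + 1)) ^ n) \<le> real d * (1 / (real d + 1)) ^ n"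
      if "x \<in> full_shift d" for n x
      using that by (auto simp: full_shift_def intro!: mult_right_mono)
  qed
  have "continuous_on (full_shift d) (\<lambda>x. real (x i))" for i
  proof (rule continuous_on_compose2[where g = real and t = UNIV])
    show "continuous_on UNIV (real :: nat \<Rightarrow> real)"
      by (simp add: continuous_on_discrete)
    show "continuous_on (full_shift d) (\<lambda>x. x i)"
      by (intro continuous_on_subset[OF continuous_on_product_coordinates subset_UNIV])
  qed simp
  then show "\<forall>\<^sub>F n in sequentially.
      continuous_on (full_shift d) (\<lambda>x. \<Sum>i<n. real (x i) * (1 / (real d + 1)) ^ i)"
    by (intro always_eventually allI continuous_on_sum continuous_on_mult continuous_on_const)
qed simp

text \<open>The default is a point of the full shift when \<open>d \<ge> 1\<close>, so that the
  total function is a map from the whole line into \<open>full_shift d\<close>, as measurability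
  into \<open>shift_borel d\<close> demands.\<close>

definition digit_decode :: "nat \<Rightarrow> real \<Rightarrow> nat \<Rightarrow> nat" where
  "digit_decode d t = (if t \<in> digit_code d ` full_shift d
     then the_inv_into (full_shift d) (digit_code d) t else (\<lambda>_. 1))"

lemma digit_decode_code:
  assumes "d \<ge> 1" "x \<in> full_shift d"
  shows "digit_decode d (digit_code d x) = x"
  using assms inj_on_digit_code by (simp add: digit_decode_def the_inv_into_f_f)

lemma continuous_on_digit_decode:
  assumes "d \<ge> 1"
  shows "continuous_on (digit_code d ` full_shift d) (digit_decode d)"
  using assms
  by (intro continuous_on_inv continuous_on_digit_code compact_full_shift)
     (simp_all add: digit_decode_code)

lemma compact_digit_code_image:
  assumes "d \<ge> 1"
  shows "compact (digit_code d ` full_shift d)"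
  using assms by (intro compact_continuous_image continuous_on_digit_code compact_full_shift)

lemma const_in_full_shift: "d \<ge> 1 \<Longrightarrow> (\<lambda>_. 1) \<in> full_shift d"
  by (simp add: full_shift_def)

lemma digit_decode_in_full_shift:
  assumes "d \<ge> 1"
  shows "digit_decode d t \<in> full_shift d"
proof (cases "t \<in> digit_code d ` full_shift d")
  case True
  then show ?thesis using digit_decode_code[OF assms] by auto
next
  case False
  then show ?thesis using const_in_full_shift[OF assms] by (simp add: digit_decode_def)
qed

text \<open>The image of the code is compact, hence a Borel set; the inverse is continuous on it and
  constant off it.\<close>

lemma measurable_digit_decode:
  assumes d: "d \<ge> 1"
  shows "digit_decode d \<in> measurable borel (shift_borel d)"
proof (rule measurable_restrict_space2)
  show "digit_decode d \<in> space borel \<rightarrow> full_shift d"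
    using digit_decode_in_full_shift[OF d] by simp
  let ?K = "digit_code d ` full_shift d"
  have "closed ?K"
    using compact_digit_code_image[OF d] by (rule compact_imp_closed)
  then have K: "?K \<in> sets borel"
    by (rule borel_closed)
  have "(\<lambda>t. if t \<in> ?K then digit_decode d t else (\<lambda>_. 1)) \<in> borel_measurable borel"
  proof (subst measurable_If_restrict_space_iff)
    show "{t \<in> space borel. t \<in> ?K} \<in> sets borel"
      using K by simp
    show "digit_decode d \<in> borel_measurable (restrict_space borel {t. t \<in> ?K}) \<and>
        (\<lambda>_. \<lambda>_. 1) \<in> borel_measurable (restrict_space borel {t. t \<notin> ?K})"
      using borel_measurable_continuous_on_restrict[OF continuous_on_digit_decode[OF d]] by simp
  qed
  also have "(\<lambda>t. if t \<in> ?K then digit_decode d t else (\<lambda>_. 1)) = digit_decode d"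
    by (auto simp: digit_decode_def)
  finally show "digit_decode d \<in> borel_measurable borel" .
qed

lemma real_distribution_digit_code:
  assumes d: "d \<ge> 1" and \<nu>: "\<nu> \<in> prob_measures d"
  shows "real_distribution (distr \<nu> borel (digit_code d))"
proof -
  interpret prob_space \<nu>
    using \<nu> by (simp add: prob_measures_def)
  show ?thesis
    using prob_measures_measurable[OF \<nu> continuous_on_digit_code[OF d]]
    by (simp add: real_distribution_def real_distribution_axioms_def prob_space_distr)
qed

text \<open>The characteristic function of the coded distribution consists of integrals of the
  cosine and sine of \<open>t * digit_code d x\<close>, which are continuous on the shift. Levy's
  uniqueness theorem identifies the coded distributions, and decoding recovers the measures.\<close>

lemma prob_measures_eqI:
  assumes d: "d \<ge> 1" and \<mu>: "\<mu> \<in> prob_measures d" and \<nu>: "\<nu> \<in> prob_measures d"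
    and eq: "\<And>g :: (nat \<Rightarrow> nat) \<Rightarrow> real. continuous_on (full_shift d) g \<Longrightarrow>
      (\<integral>x. g x \<partial>\<mu>) = (\<integral>x. g x \<partial>\<nu>)"
  shows "\<mu> = \<nu>"
proof -
  note cont = continuous_on_digit_code[OF d]
  have cos_sin: "continuous_on (full_shift d) (\<lambda>x. cos (t * digit_code d x))"
      "continuous_on (full_shift d) (\<lambda>x. sin (t * digit_code d x))" for t
    using cont
    by (auto intro!: continuous_on_compose2[where f = "digit_code d" and t = UNIV and g = "\<lambda>u. _ (t * u)"]
        continuous_intros)
  have char: "char (distr \<rho> borel (digit_code d)) t =
      complex_of_real (\<integral>x. cos (t * digit_code d x) \<partial>\<rho>) +
      \<i> * complex_of_real (\<integral>x. sin (t * digit_code d x) \<partial>\<rho>)"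
    if \<rho>: "\<rho> \<in> prob_measures d" for \<rho> t
  proof -
    have [measurable]: "digit_code d \<in> borel_measurable \<rho>"
      using prob_measures_measurable[OF \<rho> cont] .
    have int: "integrable \<rho> (\<lambda>x. cos (t * digit_code d x))"
        "integrable \<rho> (\<lambda>x. sin (t * digit_code d x))"
      using prob_measures_integrable[OF \<rho>] cos_sin by blast+
    have "char (distr \<rho> borel (digit_code d)) t = (\<integral>x. iexp (t * digit_code d x) \<partial>\<rho>)"
      unfolding char_def by (subst integral_distr) auto
    also have "\<dots> = (\<integral>x. complex_of_real (cos (t * digit_code d x)) +
        \<i> * complex_of_real (sin (t * digit_code d x)) \<partial>\<rho>)"
      by (intro Bochner_Integration.integral_cong refl) (simp add: exp_Euler cos_of_real sin_of_real del: of_real_mult)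
    also have "\<dots> = complex_of_real (\<integral>x. cos (t * digit_code d x) \<partial>\<rho>) +
      \<i> * complex_of_real (\<integral>x. sin (t * digit_code d x) \<partial>\<rho>)"
      using int by (simp add: integrable_of_real)
    finally show ?thesis .
  qed
  have "char (distr \<mu> borel (digit_code d)) = char (distr \<nu> borel (digit_code d))"
  proof
    fix t
    show "char (distr \<mu> borel (digit_code d)) t = char (distr \<nu> borel (digit_code d)) t"
      using eq cos_sin by (simp add: char[OF \<mu>] char[OF \<nu>])
  qed
  then have distr_eq: "distr \<mu> borel (digit_code d) = distr \<nu> borel (digit_code d)"
    using real_distribution_digit_code[OF d] \<mu> \<nu> by (intro Levy_uniqueness)
  have decode: "distr (distr \<rho> borel (digit_code d)) (shift_borel d) (digit_decode d) = \<rho>"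
    if \<rho>: "\<rho> \<in> prob_measures d" for \<rho>
  proof -
    have "distr (distr \<rho> borel (digit_code d)) (shift_borel d) (digit_decode d) =
        distr \<rho> (shift_borel d) (digit_decode d \<circ> digit_code d)"
      using measurable_digit_decode[OF d] prob_measures_measurable[OF \<rho> cont]
      by (rule distr_distr)
    also have "\<dots> = distr \<rho> \<rho> (\<lambda>x. x)"
      using \<rho> prob_measures_space[OF \<rho>]
      by (intro distr_cong) (auto simp: prob_measures_def digit_decode_code[OF d])
    finally show ?thesis by (simp add: distr_id2)
  qed
  show ?thesis
    using distr_eq decode[OF \<mu>] decode[OF \<nu>] by metis
qed

text \<open>The coded distributions live on one bounded interval, so they are tight and converge
  weakly along a subsequence. It remains to see that the limit is carried by the image of the code,
  so that it can be pulled back to the shift.\<close>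

lemma prob_measures_weak_star_compact:
  fixes \<nu> :: "nat \<Rightarrow> (nat \<Rightarrow> nat) measure"
  assumes d: "d \<ge> 1" and \<nu>: "\<And>j. \<nu> j \<in> prob_measures d"
  obtains r \<mu> where "strict_mono r" "weak_star_limit d (\<lambda>j. \<nu> (r j)) \<mu>"
proof -
  let ?K = "digit_code d ` full_shift d"
  define M where "M j = distr (\<nu> j) borel (digit_code d)" for j
  note cont = continuous_on_digit_code[OF d]
  have meas: "digit_code d \<in> borel_measurable (\<nu> j)" for j
    using prob_measures_measurable[OF \<nu> cont] .
  have M: "real_distribution (M j)" for j
    unfolding M_def using real_distribution_digit_code[OF d \<nu>] .
  have K_Ioc: "?K \<subseteq> {-1<..real d + 1}"
  proof
    fix t assume "t \<in> ?K"
    then show "t \<in> {-1<..real d + 1}"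
      using digit_code_bounds[OF d] d by (force intro: less_le_trans[of _ 0] order_trans[rotated])
  qed
  have "measure (M j) {-1<..real d + 1} = 1" for j
  proof -
    interpret prob_space "\<nu> j"
      using \<nu> by (simp add: prob_measures_def)
    have "measure (M j) {-1<..real d + 1} =
        measure (\<nu> j) (digit_code d -` {-1<..real d + 1} \<inter> space (\<nu> j))"
      unfolding M_def by (rule measure_distr[OF meas]) simp
    also have "digit_code d -` {-1<..real d + 1} \<inter> space (\<nu> j) = space (\<nu> j)"
      using K_Ioc prob_measures_space[OF \<nu>] by auto
    finally show ?thesis by (simp add: prob_space)
  qed
  then have "tight M"
    unfolding tight_def using M
    by (intro conjI allI impI exI[of _ "-1"] exI[of _ "real d + 1"]) auto
  then obtain r N where r: "strict_mono (r :: nat \<Rightarrow> nat)" and N: "real_distribution N"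
    and "weak_conv_m (M \<circ> id \<circ> r) N"
    using tight_imp_convergent_subsubsequence[of M id] strict_mono_id by blast
  then have conv: "weak_conv_m (\<lambda>j. M (r j)) N"
    by (simp add: comp_def)
  interpret N: real_distribution N by (rule N)
  have lim: "(\<lambda>j. integral\<^sup>L (M (r j)) h) \<longlonglongrightarrow> integral\<^sup>L N h"
    if "continuous_on UNIV h" "\<And>t. \<bar>h t\<bar> \<le> B" for h :: "real \<Rightarrow> real" and B
    using that M N conv
    by (intro weak_conv_imp_integral_bdd_continuous_conv[where B = B])
       (auto simp: continuous_on_eq_continuous_at)
  have int_M: "integral\<^sup>L (M j) h = (\<integral>x. h (digit_code d x) \<partial>\<nu> j)"
    if "continuous_on UNIV h" for h :: "real \<Rightarrow> real" and j
    unfolding M_def using that meas by (intro integral_distr borel_measurable_continuous_onI)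
  have K: "closed ?K" "?K \<noteq> {}"
    using compact_imp_closed[OF compact_digit_code_image[OF d]] const_in_full_shift[OF d] by auto
  have AE_K: "AE t in N. t \<in> ?K"
  proof -
    \<comment> \<open>Zero exactly on the closed set \<open>?K\<close>; the truncation at 1 makes it
      a bounded test function for weak convergence.\<close>
    define h where "h t = min 1 (infdist t ?K)" for t
    have h: "continuous_on UNIV h" "0 \<le> h t" "\<bar>h t\<bar> \<le> 1" for t
      by (auto simp: h_def infdist_nonneg intro!: continuous_intros)
    have "integral\<^sup>L (M j) h = 0" for j
    proof -
      have "integral\<^sup>L (M j) h = (\<integral>x. 0 \<partial>\<nu> j)"
        unfolding int_M[OF h(1)] using prob_measures_space[OF \<nu>]
        by (intro Bochner_Integration.integral_cong) (auto simp: h_def)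
      then show ?thesis by simp
    qed
    then have "integral\<^sup>L N h = 0"
      using lim[OF h(1,3)] by (simp add: LIMSEQ_const_iff)
    moreover have "integrable N h"
      using h by (intro N.integrable_const_bound[where B = 1])
        (auto intro!: borel_measurable_continuous_onI simp: measurable_cong_sets[OF N.events_eq_borel refl])
    ultimately have "AE t in N. h t = 0"
      using integral_nonneg_eq_0_iff_AE[of N h] h(2) by simp
    then show ?thesis
    proof (rule AE_mp, intro AE_I2 impI)
      fix t assume "h t = 0"
      then have "infdist t ?K = 0"
        by (auto simp: h_def min_def split: if_splits)
      then show "t \<in> ?K"
        using in_closed_iff_infdist_zero[OF K] by blast
    qed
  qed
  define \<mu> where "\<mu> = distr N (shift_borel d) (digit_decode d)"
  have decode: "digit_decode d \<in> measurable N (shift_borel d)"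
    using measurable_digit_decode[OF d] by (simp cong: measurable_cong_sets)
  have \<mu>: "\<mu> \<in> prob_measures d"
    unfolding prob_measures_def \<mu>_def using N.prob_space_distr[OF decode] by simp
  have "(\<lambda>j. \<integral>x. g x \<partial>\<nu> (r j)) \<longlonglongrightarrow> (\<integral>x. g x \<partial>\<mu>)"
    if g: "continuous_on (full_shift d) g" for g :: "(nat \<Rightarrow> nat) \<Rightarrow> real"
  proof -
    obtain B where B: "B > 0" "\<And>x. x \<in> full_shift d \<Longrightarrow> \<bar>g x\<bar> \<le> B"
      using continuous_on_full_shift_bounded[OF g] by blast
    have g_decode: "continuous_on ?K (\<lambda>t. g (digit_decode d t))"
      using continuous_on_digit_decode[OF d] digit_decode_in_full_shift[OF d]
      by (intro continuous_on_compose2[OF g]) auto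
    \<comment> \<open>Weak convergence on the line tests functions on the whole line, while the
      decoded \<open>g\<close> is known to be continuous on \<open>?K\<close> only. Tietze's theorem
      extends it with the same bound.\<close>
    obtain G where G: "continuous_on UNIV G" "\<And>t. t \<in> ?K \<Longrightarrow> G t = g (digit_decode d t)"
        "\<And>t. norm (G t) \<le> B"
      using Tietze[OF g_decode, of UNIV B] K(1) B digit_decode_in_full_shift[OF d] by auto
    have [measurable]: "G \<in> borel_measurable borel"
      using G(1) by (rule borel_measurable_continuous_onI)
    have g_meas: "g \<in> borel_measurable (shift_borel d)"
      using g by (rule borel_measurable_continuous_on_restrict)
    have "integral\<^sup>L (M (r j)) G = (\<integral>x. g x \<partial>\<nu> (r j))" for j
      unfolding int_M[OF G(1)]
      by (intro Bochner_Integration.integral_cong)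
         (auto simp: prob_measures_space[OF \<nu>] G(2) digit_decode_code[OF d])
    moreover have "integral\<^sup>L N G = (\<integral>x. g x \<partial>\<mu>)"
    proof -
      have "(\<integral>x. g x \<partial>\<mu>) = (\<integral>t. g (digit_decode d t) \<partial>N)"
        unfolding \<mu>_def by (rule integral_distr[OF decode g_meas])
      also have "\<dots> = integral\<^sup>L N G"
        using AE_K G(2) measurable_compose[OF decode g_meas]
        by (intro integral_cong_AE) auto
      finally show ?thesis by simp
    qed
    ultimately show ?thesis
      using lim[OF G(1), of B] G(3) by simp
  qed
  then show thesis
    using that[OF r] \<mu> unfolding weak_star_limit_def by blast
qed

section \<open>Invariant measures\<close>

text \<open>A finitely supported distribution on the index type is pushed forward by
  \<open>h\<close>. Distinct indices may name the same point, so orbits can be counted with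
  multiplicity.\<close>

lemma finite_mixture_exists:
  fixes w :: "'a \<Rightarrow> real" and h :: "'a \<Rightarrow> nat \<Rightarrow> nat"
  assumes d: "d \<ge> 1" and A: "finite A" and w: "\<And>a. a \<in> A \<Longrightarrow> w a \<ge> 0" "sum w A = 1"
    and h: "\<And>a. a \<in> A \<Longrightarrow> h a \<in> full_shift d"
  obtains \<nu> where "\<nu> \<in> prob_measures d"
    "\<And>g :: (nat \<Rightarrow> nat) \<Rightarrow> real. continuous_on (full_shift d) g \<Longrightarrow>
      (\<integral>x. g x \<partial>\<nu>) = (\<Sum>a\<in>A. w a * g (h a))"
proof -
  \<comment> \<open>The probability mass function and the map live on the whole type, so weights are
    extended by 0 and points by an element of the full shift.\<close>
  define v where "v a = (if a \<in> A then w a else 0)" for a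
  define p where "p = embed_pmf v"
  define h' where "h' a = (if a \<in> A then h a else (\<lambda>_. 1))" for a
  have "(\<integral>\<^sup>+a. ennreal (v a) \<partial>count_space UNIV) = (\<Sum>a\<in>A. ennreal (v a))"
    using A by (intro nn_integral_count_space') (auto simp: v_def)
  also have "\<dots> = ennreal (\<Sum>a\<in>A. v a)"
    using w by (intro sum_ennreal) (auto simp: v_def)
  also have "(\<Sum>a\<in>A. v a) = 1"
    using w by (simp add: v_def)
  finally have p: "pmf p a = v a" for a
    unfolding p_def using w by (intro pmf_embed_pmf) (auto simp: v_def)
  have h': "h' \<in> measurable (measure_pmf p) (shift_borel d)"
    using h const_in_full_shift[OF d] by (auto simp: h'_def space_shift_borel)
  show thesis
  proof (rule that[of "distr (measure_pmf p) (shift_borel d) h'"])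
    show "distr (measure_pmf p) (shift_borel d) h' \<in> prob_measures d"
      unfolding prob_measures_def using measure_pmf.prob_space_distr[OF h'] by simp
    fix g :: "(nat \<Rightarrow> nat) \<Rightarrow> real" assume g: "continuous_on (full_shift d) g"
    have "(\<integral>x. g x \<partial>distr (measure_pmf p) (shift_borel d) h') = (\<integral>a. g (h' a) \<partial>measure_pmf p)"
      using h' borel_measurable_continuous_on_restrict[OF g] by (rule integral_distr)
    also have "\<dots> = (\<Sum>a\<in>A. g (h' a) * pmf p a)"
      using A by (intro integral_measure_pmf_real) (auto simp: set_pmf_iff p v_def split: if_splits)
    also have "\<dots> = (\<Sum>a\<in>A. w a * g (h a))"
      by (intro sum.cong) (auto simp: p v_def h'_def)
    finally show "(\<integral>x. g x \<partial>distr (measure_pmf p) (shift_borel d) h') = (\<Sum>a\<in>A. w a * g (h a))" .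
  qed
qed

lemma measurable_shift:
  assumes "\<nu> \<in> prob_measures d"
  shows "shift \<in> measurable \<nu> \<nu>"
proof -
  have "shift \<in> measurable (shift_borel d) (shift_borel d)"
    using borel_measurable_continuous_onI[OF continuous_on_shift] shift_in_full_shift
    by (intro measurable_restrict_space3) auto
  moreover have "sets \<nu> = sets (shift_borel d)"
    using assms by (simp add: prob_measures_def)
  ultimately show ?thesis by (simp cong: measurable_cong_sets)
qed

lemma continuous_on_comp_shift:
  assumes "continuous_on (full_shift d) g"
  shows "continuous_on (full_shift d) (\<lambda>x. g (shift x))"
  using continuous_on_compose2[OF assms continuous_on_shift] shift_in_full_shift by blast

text \<open>Integrals of continuous functions determine the measure, so they suffice to test
  invariance. In this form invariance passes to weak* limits.\<close>

lemma invariant_measuresI: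
  assumes d: "d \<ge> 1" and \<nu>: "\<nu> \<in> prob_measures d"
    and inv: "\<And>g :: (nat \<Rightarrow> nat) \<Rightarrow> real. continuous_on (full_shift d) g \<Longrightarrow>
      (\<integral>x. g (shift x) \<partial>\<nu>) = (\<integral>x. g x \<partial>\<nu>)"
  shows "\<nu> \<in> invariant_measures d"
proof -
  interpret prob_space \<nu>
    using \<nu> by (simp add: prob_measures_def)
  have "distr \<nu> \<nu> shift \<in> prob_measures d"
    using \<nu> prob_space_distr[OF measurable_shift[OF \<nu>]] by (simp add: prob_measures_def)
  then have "distr \<nu> \<nu> shift = \<nu>"
  proof (rule prob_measures_eqI[OF d _ \<nu>])
    fix g :: "(nat \<Rightarrow> nat) \<Rightarrow> real" assume g: "continuous_on (full_shift d) g"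
    show "(\<integral>x. g x \<partial>distr \<nu> \<nu> shift) = (\<integral>x. g x \<partial>\<nu>)"
      using inv[OF g] integral_distr[OF measurable_shift[OF \<nu>] prob_measures_measurable[OF \<nu> g]]
      by simp
  qed
  then show ?thesis using \<nu> by (simp add: invariant_measures_def)
qed

lemma invariant_measures_integral_shift:
  fixes g :: "(nat \<Rightarrow> nat) \<Rightarrow> real"
  assumes \<nu>: "\<nu> \<in> invariant_measures d" and g: "continuous_on (full_shift d) g"
  shows "(\<integral>x. g (shift x) \<partial>\<nu>) = (\<integral>x. g x \<partial>\<nu>)"
proof -
  have \<nu>': "\<nu> \<in> prob_measures d" "distr \<nu> \<nu> shift = \<nu>"
    using \<nu> by (auto simp: invariant_measures_def)
  show ?thesis
    using integral_distr[OF measurable_shift[OF \<nu>'(1)] prob_measures_measurable[OF \<nu>'(1) g]] \<nu>'(2)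
    by simp
qed

lemma weak_star_limit_invariant:
  assumes d: "d \<ge> 1" and \<nu>: "\<And>j. \<nu> j \<in> invariant_measures d" and lim: "weak_star_limit d \<nu> \<mu>"
  shows "\<mu> \<in> invariant_measures d"
proof (rule invariant_measuresI[OF d])
  show "\<mu> \<in> prob_measures d"
    using lim by (simp add: weak_star_limit_def)
  fix g :: "(nat \<Rightarrow> nat) \<Rightarrow> real" assume g: "continuous_on (full_shift d) g"
  have "(\<lambda>j. \<integral>x. g (shift x) \<partial>\<nu> j) \<longlonglongrightarrow> (\<integral>x. g (shift x) \<partial>\<mu>)"
    using lim continuous_on_comp_shift[OF g] unfolding weak_star_limit_def by blast
  moreover have "(\<lambda>j. \<integral>x. g (shift x) \<partial>\<nu> j) \<longlonglongrightarrow> (\<integral>x. g x \<partial>\<mu>)"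
    unfolding invariant_measures_integral_shift[OF \<nu> g]
    using lim g unfolding weak_star_limit_def by blast
  ultimately show "(\<integral>x. g (shift x) \<partial>\<mu>) = (\<integral>x. g x \<partial>\<mu>)"
    by (rule LIMSEQ_unique)
qed

section \<open>Birkhoff sums, orbit measures and the maximal value\<close>

lemma birkhoff_sum_0 [simp]: "birkhoff_sum T g 0 x = 0"
  by (simp add: birkhoff_sum_def)

lemma birkhoff_sum_Suc: "birkhoff_sum T g (Suc n) x = g x + birkhoff_sum T g n (T x)"
  unfolding birkhoff_sum_def by (simp add: sum.lessThan_Suc_shift funpow_Suc_right del: funpow.simps sum.lessThan_Suc)

lemma birkhoff_sum_add:
  "birkhoff_sum T g (m + n) x = birkhoff_sum T g m x + birkhoff_sum T g n ((T ^^ m) x)"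
  by (induction m arbitrary: x) (simp_all add: birkhoff_sum_Suc funpow_Suc_right del: funpow.simps(2))

lemma birkhoff_sum_cmult: "birkhoff_sum T (\<lambda>y. c * g y) n x = c * birkhoff_sum T g n x"
  by (simp add: birkhoff_sum_def sum_distrib_left)

lemma continuous_on_birkhoff_sum:
  assumes "continuous_on (full_shift d) g"
  shows "continuous_on (full_shift d) (birkhoff_sum shift g n)"
proof (induction n)
  case (Suc n)
  then show ?case
    using assms continuous_on_comp_shift unfolding birkhoff_sum_Suc by (intro continuous_on_add)
qed simp

lemma integral_birkhoff_sum:
  assumes \<nu>: "\<nu> \<in> invariant_measures d" and g: "continuous_on (full_shift d) g"
  shows "(\<integral>x. birkhoff_sum shift g n x \<partial>\<nu>) = real n * (\<integral>x. g x \<partial>\<nu>)"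
proof (induction n)
  case (Suc n)
  have \<nu>': "\<nu> \<in> prob_measures d"
    using \<nu> by (simp add: invariant_measures_def)
  note cont = continuous_on_birkhoff_sum[OF g, of n]
  have "(\<integral>x. birkhoff_sum shift g (Suc n) x \<partial>\<nu>) =
      (\<integral>x. g x \<partial>\<nu>) + (\<integral>x. birkhoff_sum shift g n (shift x) \<partial>\<nu>)"
    unfolding birkhoff_sum_Suc
    using g continuous_on_comp_shift[OF cont] prob_measures_integrable[OF \<nu>']
    by (intro Bochner_Integration.integral_add) blast+
  then show ?case
    using Suc invariant_measures_integral_shift[OF \<nu> cont] by (simp add: algebra_simps)
qed simp

lemma Fix_in_full_shift: "x \<in> Fix d n \<Longrightarrow> x \<in> full_shift d"
  by (simp add: Fix_def)

lemma birkhoff_sum_comp_shift_Fix: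
  assumes "x \<in> Fix d n"
  shows "birkhoff_sum shift (\<lambda>y. g (shift y)) n x = birkhoff_sum shift g n x"
proof -
  have "birkhoff_sum shift (\<lambda>y. g (shift y)) n x = birkhoff_sum shift g n (shift x)"
    by (simp add: birkhoff_sum_def funpow_swap1)
  \<comment> \<open>The sum of length \<open>n + 1\<close> is split at its first term and at its
    last term.\<close>
  moreover have "g x + birkhoff_sum shift g n (shift x) = birkhoff_sum shift g n x + g ((shift ^^ n) x)"
    using birkhoff_sum_Suc[of shift g n x] by (simp add: birkhoff_sum_def)
  ultimately show ?thesis using assms by (simp add: Fix_def)
qed

text \<open>The equidistribution on the first \<open>n\<close> iterates is invariant because a
  function and its composition with the shift have the same sum over a closed orbit.
  \<open>n\<close> may be a multiple of the least period.\<close>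

lemma orbit_measure_exists:
  assumes d: "d \<ge> 1" and n: "n > 0" and x: "x \<in> Fix d n"
  obtains \<nu> where "\<nu> \<in> invariant_measures d"
    "\<And>g :: (nat \<Rightarrow> nat) \<Rightarrow> real. continuous_on (full_shift d) g \<Longrightarrow>
      (\<integral>x. g x \<partial>\<nu>) = birkhoff_sum shift g n x / real n"
proof -
  obtain \<nu> where \<nu>: "\<nu> \<in> prob_measures d"
    and "\<And>g :: (nat \<Rightarrow> nat) \<Rightarrow> real. continuous_on (full_shift d) g \<Longrightarrow>
      (\<integral>x. g x \<partial>\<nu>) = (\<Sum>i<n. 1 / real n * g ((shift ^^ i) x))"
    using finite_mixture_exists[OF d, of "{..<n}" "\<lambda>_. 1 / real n" "\<lambda>i. (shift ^^ i) x"]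
      n funpow_shift_in_full_shift[OF Fix_in_full_shift[OF x]] by auto
  then have int: "(\<integral>x. g x \<partial>\<nu>) = birkhoff_sum shift g n x / real n"
    if "continuous_on (full_shift d) g" for g :: "(nat \<Rightarrow> nat) \<Rightarrow> real"
    using that by (simp add: birkhoff_sum_def sum_divide_distrib)
  have "\<nu> \<in> invariant_measures d"
    using int int[OF continuous_on_comp_shift]
    by (intro invariant_measuresI[OF d \<nu>]) (simp add: birkhoff_sum_comp_shift_Fix[OF x])
  then show thesis using int that by blast
qed

text \<open>\<open>max_value\<close> is a supremum of reals, so it is an upper bound only once the
  integrals are known to be bounded; a bound of \<open>f\<close> on the compact shift provides
  this.\<close>

lemma max_value_upper:
  assumes f: "continuous_on (full_shift d) f" and \<nu>: "\<nu> \<in> invariant_measures d"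
  shows "(\<integral>x. f x \<partial>\<nu>) \<le> max_value d f"
proof -
  obtain B where B: "\<And>x. x \<in> full_shift d \<Longrightarrow> \<bar>f x\<bar> \<le> B"
    using continuous_on_full_shift_bounded[OF f] by metis
  have "(\<integral>x. f x \<partial>\<mu>) \<le> B" if "\<mu> \<in> invariant_measures d" for \<mu>
  proof -
    have \<mu>: "\<mu> \<in> prob_measures d" "prob_space \<mu>"
      using that by (auto simp: invariant_measures_def prob_measures_def)
    then show ?thesis
      using B prob_measures_space[OF \<mu>(1)] prob_measures_integrable[OF \<mu>(1) f]
      by (intro prob_space.integral_le_const) (auto intro!: AE_I2 dest: B abs_le_D1)
  qed
  then show ?thesis
    unfolding max_value_def using \<nu> by (intro cSUP_upper bdd_aboveI2)
qed

lemma const_in_Fix: "d \<ge> 1 \<Longrightarrow> (\<lambda>_. 1) \<in> Fix d n"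
  using const_in_full_shift by (auto simp: Fix_def funpow_shift)

lemma invariant_measures_nonempty: "d \<ge> 1 \<Longrightarrow> invariant_measures d \<noteq> {}"
  using orbit_measure_exists[OF _ zero_less_one const_in_Fix] by (metis empty_iff)

text \<open>The orbit average is the integral of \<open>f\<close> against an invariant
  measure.\<close>

lemma birkhoff_sum_Fix_le:
  assumes d: "d \<ge> 1" and f: "continuous_on (full_shift d) f" and x: "x \<in> Fix d n"
  shows "birkhoff_sum shift f n x \<le> real n * max_value d f"
proof (cases "n = 0")
  case False
  then show ?thesis
    using orbit_measure_exists[OF d _ x] max_value_upper[OF f] f
    by (metis divide_le_eq mult.commute neq0_conv of_nat_0_less_iff)
qed simp

text \<open>The maximum of the continuous function \<open>birkhoff_sum shift f n\<close> dominates
  its integral against every invariant measure, which is \<open>n\<close> times the integral of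
  \<open>f\<close>. The maximizing point serves all these measures at once.\<close>

lemma birkhoff_sum_ge_max_value:
  assumes d: "d \<ge> 1" and f: "continuous_on (full_shift d) f"
  obtains x where "x \<in> full_shift d" "birkhoff_sum shift f n x \<ge> real n * max_value d f"
proof -
  obtain x where x: "x \<in> full_shift d"
    "\<And>y. y \<in> full_shift d \<Longrightarrow> birkhoff_sum shift f n y \<le> birkhoff_sum shift f n x"
    using continuous_attains_sup[OF compact_full_shift _ continuous_on_birkhoff_sum[OF f]]
      const_in_full_shift[OF d] by blast
  have "real n * (\<integral>x. f x \<partial>\<nu>) \<le> birkhoff_sum shift f n x" if \<nu>: "\<nu> \<in> invariant_measures d" for \<nu>
  proof -
    have \<nu>': "\<nu> \<in> prob_measures d" "prob_space \<nu>"
      using \<nu> by (auto simp: invariant_measures_def prob_measures_def)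
    have "(\<integral>x. birkhoff_sum shift f n x \<partial>\<nu>) \<le> birkhoff_sum shift f n x"
      using x prob_measures_space[OF \<nu>'(1)]
        prob_measures_integrable[OF \<nu>'(1) continuous_on_birkhoff_sum[OF f]]
      by (intro prob_space.integral_le_const[OF \<nu>'(2)]) (auto intro!: AE_I2)
    then show ?thesis using integral_birkhoff_sum[OF \<nu> f] by simp
  qed
  then have "real n * max_value d f \<le> birkhoff_sum shift f n x"
  proof (cases "n = 0")
    case False
    assume *: "\<And>\<nu>. \<nu> \<in> invariant_measures d \<Longrightarrow>
      real n * (\<integral>x. f x \<partial>\<nu>) \<le> birkhoff_sum shift f n x"
    have "max_value d f \<le> birkhoff_sum shift f n x / real n"
      unfolding max_value_def using * False invariant_measures_nonempty[OF d]
      by (intro cSUP_least) (auto simp: field_simps)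
    then show ?thesis using False by (simp add: field_simps)
  qed simp
  then show thesis using that x by blast
qed

section \<open>Lipschitz potentials and periodic orbits\<close>

locale lipschitz_potential =
  fixes d :: nat and \<theta> :: real and f :: "(nat \<Rightarrow> nat) \<Rightarrow> real" and B :: real
  assumes d: "d \<ge> 1" and theta: "0 < \<theta>" "\<theta> < 1" and B: "B \<ge> 0"
    and lip: "\<And>x y. x \<in> full_shift d \<Longrightarrow> y \<in> full_shift d \<Longrightarrow> \<bar>f x - f y\<bar> \<le> B * theta_dist \<theta> x y"
    and cont: "continuous_on (full_shift d) f"
begin

abbreviation \<beta> :: real where "\<beta> \<equiv> max_value d f"
abbreviation S :: "nat \<Rightarrow> (nat \<Rightarrow> nat) \<Rightarrow> real" where "S \<equiv> birkhoff_sum shift f"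

lemma theta_dist_le:
  assumes "\<And>i. i < k \<Longrightarrow> x i = y i"
  shows "theta_dist \<theta> x y \<le> \<theta> ^ k"
proof (cases "x = y")
  case False
  then obtain n where "x n \<noteq> y n" by auto
  then have "x (LEAST n. x n \<noteq> y n) \<noteq> y (LEAST n. x n \<noteq> y n)"
    by (rule LeastI)
  then have "k \<le> (LEAST n. x n \<noteq> y n)"
    using assms not_le by blast
  then show ?thesis
    using False theta by (simp add: theta_dist_def power_decreasing)
qed (use theta in \<open>simp add: theta_dist_def\<close>)

text \<open>After \<open>i\<close> shifts the points still agree on \<open>n + k - i\<close>
  symbols, so the differences of the values of \<open>f\<close> are dominated by a geometric series
  whose largest term is \<open>B * \<theta> ^ k\<close>. The bound is therefore independent of
  \<open>n\<close>.\<close>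

lemma birkhoff_sum_diff_le:
  assumes x: "x \<in> full_shift d" and y: "y \<in> full_shift d" and eq: "\<And>i. i < n + k \<Longrightarrow> x i = y i"
  shows "\<bar>S n x - S n y\<bar> \<le> B * \<theta> ^ k / (1 - \<theta>)"
proof -
  have "\<bar>S n x - S n y\<bar> \<le> B * \<theta> ^ k * (\<Sum>i<n. \<theta> ^ i)"
    using assms
  proof (induction n arbitrary: x y)
    case (Suc n)
    \<comment> \<open>One symbol of the agreement is given away, so that this term is exactly the
      new last term of the geometric sum.\<close>
    have "theta_dist \<theta> x y \<le> \<theta> ^ (n + k)"
      using Suc.prems(3) by (intro theta_dist_le) simp
    then have "\<bar>f x - f y\<bar> \<le> B * \<theta> ^ (n + k)"
      using lip[OF Suc.prems(1,2)] B by (meson mult_left_mono order_trans)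
    moreover have "\<bar>S n (shift x) - S n (shift y)\<bar> \<le> B * \<theta> ^ k * (\<Sum>i<n. \<theta> ^ i)"
      using Suc.prems by (intro Suc.IH shift_in_full_shift) (auto simp: shift_def)
    ultimately show ?case
      unfolding birkhoff_sum_Suc by (simp add: power_add algebra_simps)
  qed simp
  also have "\<dots> \<le> B * \<theta> ^ k * (1 / (1 - \<theta>))"
    using theta B sum_le_suminf[of "\<lambda>i. \<theta> ^ i" "{..<n}"]
    by (intro mult_left_mono) (auto simp: suminf_geometric summable_geometric)
  finally show ?thesis by simp
qed

text \<open>Repeating the first \<open>N\<close> symbols of \<open>x\<close> gives \<open>p\<close>.
  The return of the \<open>k\<close>-block prolongs the agreement to \<open>N + k\<close> symbols,
  by induction in steps of \<open>N\<close> because \<open>k\<close> may exceed \<open>N\<close>;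
  then the distortion bound applies.\<close>

lemma closing:
  assumes x: "x \<in> full_shift d" and N: "N > 0" and return: "\<And>i. i < k \<Longrightarrow> x (N + i) = x i"
  obtains p where "p \<in> Fix d N" "\<bar>S N x - S N p\<bar> \<le> B * \<theta> ^ k / (1 - \<theta>)"
proof -
  define p where "p i = x (i mod N)" for i
  have p: "p \<in> Fix d N"
    using x by (auto simp: p_def Fix_def full_shift_def funpow_shift)
  have "x i = p i" if "i < N + k" for i
    using that
  proof (induction i rule: less_induct)
    case (less i)
    show ?case
    proof (cases "i < N")
      case False
      then have "x i = x (i - N)"
        using return[of "i - N"] less.prems by simp
      also have "\<dots> = p (i - N)"
        using False less N by simp
      finally show ?thesis
        using False by (simp add: p_def le_mod_geq)
    qed (simp add: p_def)
  qed
  then show thesis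
    using that[OF p birkhoff_sum_diff_le[OF x Fix_in_full_shift[OF p], of N k]] by blast
qed

text \<open>Closing with \<open>k = 0\<close> asks for no recurrence: every segment is shadowed by a
  periodic orbit at a cost independent of \<open>n\<close>, and on periodic orbits the bound by
  \<open>\<beta>\<close> is exact.\<close>

lemma birkhoff_sum_le:
  assumes x: "x \<in> full_shift d"
  shows "S n x \<le> real n * \<beta> + B / (1 - \<theta>)"
proof (cases "n = 0")
  case True
  then show ?thesis using B theta by simp
next
  case False
  then obtain p where "p \<in> Fix d n" "\<bar>S n x - S n p\<bar> \<le> B * \<theta> ^ 0 / (1 - \<theta>)"
    using closing[OF x, of n 0] by auto
  then show ?thesis
    using birkhoff_sum_Fix_le[OF d cont, of p n] by simp
qed

text \<open>Along an orbit segment of almost maximal Birkhoff sum, \<open>S t x - t \<beta>\<close> stays in a bounded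
  window. Hence two times with the same \<open>k\<close>-block and almost the same value of
  \<open>S t x - t \<beta>\<close> exist by pigeonhole, and closing up between them gives the periodic orbit.\<close>

lemma periodic_near_maximal:
  assumes \<eta>: "\<eta> > 0"
  obtains N p where "N > 0" "p \<in> Fix d N" "S N p \<ge> real N * \<beta> - \<eta>"
proof -
  define C where "C = B / (1 - \<theta>)"
  \<comment> \<open>Half of \<open>\<eta>\<close> pays for the error of closing up, the other half
    for the width of a cell of the window.\<close>
  define \<delta> where "\<delta> = \<eta> / 2"
  have \<delta>: "\<delta> > 0" and C: "C \<ge> 0"
    using \<eta> B theta by (auto simp: \<delta>_def C_def)
  obtain k where k: "B * \<theta> ^ k / (1 - \<theta>) \<le> \<delta>"
  proof -
    have "(\<lambda>k. C * \<theta> ^ k) \<longlonglongrightarrow> C * 0"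
      using theta by (intro tendsto_mult_left LIMSEQ_realpow_zero) auto
    then have "\<forall>\<^sub>F k in sequentially. C * \<theta> ^ k < \<delta>"
      using \<delta> by (intro order_tendstoD) auto
    then obtain k where "C * \<theta> ^ k < \<delta>"
      by (auto simp: eventually_sequentially)
    then show thesis
      using that[of k] by (simp add: C_def)
  qed
  define W where "W = {xs. set xs \<subseteq> {1..d} \<and> length xs = k}"
  define J where "J = {\<lfloor>- C / \<delta>\<rfloor>..\<lfloor>C / \<delta>\<rfloor>}"
  have fin: "finite (W \<times> J)"
    by (simp add: W_def J_def finite_lists_length_eq)
  \<comment> \<open>The length is the number of cells, fixed before the point \<open>x\<close> that
    depends on it. The \<open>n + 1\<close> times from 0 to \<open>n\<close> cannot all fall into
    different cells.\<close>
  define n where "n = card (W \<times> J)"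
  obtain x where x: "x \<in> full_shift d" "S n x \<ge> real n * \<beta>"
    using birkhoff_sum_ge_max_value[OF d cont] by blast
  define D where "D t = S t x - real t * \<beta>" for t
  define h where "h t = (map (\<lambda>i. x (t + i)) [0..<k], \<lfloor>D t / \<delta>\<rfloor>)" for t
  have "h t \<in> W \<times> J" if t: "t \<le> n" for t
  proof -
    \<comment> \<open>The lower edge of the window: the total ends at or above
      \<open>n * \<beta>\<close>, and the part after time \<open>t\<close> can exceed its share by
      at most \<open>C\<close>.\<close>
    have "S n x = S t x + S (n - t) ((shift ^^ t) x)"
      using birkhoff_sum_add[of shift f t "n - t" x] t by simp
    then have "D t \<ge> - C"
      using birkhoff_sum_le[OF funpow_shift_in_full_shift[OF x(1)], of "n - t" t] x(2) t
      by (simp add: D_def C_def of_nat_diff algebra_simps)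
    moreover have "D t \<le> C"
      using birkhoff_sum_le[OF x(1), of t] by (simp add: D_def C_def)
    ultimately have "\<lfloor>D t / \<delta>\<rfloor> \<in> J"
      using \<delta> unfolding J_def by (auto intro!: floor_mono simp: field_simps)
    moreover have "map (\<lambda>i. x (t + i)) [0..<k] \<in> W"
      using x(1) by (auto simp: W_def full_shift_def)
    ultimately show ?thesis by (simp add: h_def)
  qed
  then have "h ` {..n} \<subseteq> W \<times> J"
    by blast
  then have "card (h ` {..n}) \<le> n"
    using card_mono[OF fin] n_def by metis
  then have "\<not> inj_on h {..n}"
    by (intro pigeonhole) simp
  then obtain a b where ab: "a < b" "b \<le> n" "h a = h b"
    unfolding inj_on_def by (metis atMost_iff linorder_neqE_nat)
  define N where "N = b - a"
  define y where "y = (shift ^^ a) x"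
  have y: "y \<in> full_shift d"
    using x(1) by (simp add: y_def funpow_shift_in_full_shift)
  have N: "N > 0" "b = a + N"
    using ab by (auto simp: N_def)
  have "map (\<lambda>i. x (a + i)) [0..<k] = map (\<lambda>i. x (b + i)) [0..<k]"
    using ab(3) by (simp add: h_def)
  then have "y (N + i) = y i" if "i < k" for i
    using that N(2) by (simp add: y_def funpow_shift add.assoc)
  then obtain p where p: "p \<in> Fix d N" "\<bar>S N y - S N p\<bar> \<le> B * \<theta> ^ k / (1 - \<theta>)"
    using closing[OF y N(1)] by blast
  have "\<lfloor>D a / \<delta>\<rfloor> = \<lfloor>D b / \<delta>\<rfloor>"
    using ab(3) by (simp add: h_def)
  then have "D a / \<delta> - D b / \<delta> < 1"
    by linarith
  then have "D a - D b < \<delta>"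
    using \<delta> by (simp add: field_simps)
  moreover have "S b x = S a x + S N y"
    using birkhoff_sum_add[of shift f a N x] N(2) by (simp add: y_def)
  ultimately have "S N y \<ge> real N * \<beta> - \<delta>"
    using N(2) by (simp add: D_def algebra_simps)
  then have "S N p \<ge> real N * \<beta> - \<eta>"
    using p(2) k unfolding \<delta>_def by linarith
  then show thesis
    using that N(1) p(1) by blast
qed

end

section \<open>Bounds on the pressure\<close>

lemma shift_metric_simps:
  assumes "0 < \<theta>" "\<theta> < 1"
  shows "mspace (shift_metric d \<theta>) = full_shift d" "mdist (shift_metric d \<theta>) = theta_dist \<theta>"
  using Metric_space.mspace_metric[OF Metric_space_theta_dist[OF assms]]
    Metric_space.mdist_metric[OF Metric_space_theta_dist[OF assms]]
  by (simp_all add: shift_metric_def)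

text \<open>Counts periodic points by one period and separated sets by slightly longer
  prefixes.\<close>

lemma card_le_if_inj_on_prefix:
  assumes A: "A \<subseteq> full_shift d" and inj: "inj_on (\<lambda>x. map x [0..<n]) A"
  shows "finite A" "card A \<le> d ^ n"
proof -
  let ?L = "{xs. set xs \<subseteq> {1..d} \<and> length xs = n}"
  have im: "(\<lambda>x. map x [0..<n]) ` A \<subseteq> ?L"
    using subsetD[OF A] by (auto simp: full_shift_def)
  have L: "finite ?L" "card ?L = d ^ n"
    using finite_lists_length_eq[of "{1..d}"] card_lists_length_eq[of "{1..d}"] by simp_all
  show "finite A"
    using finite_imageD[OF finite_subset[OF im L(1)] inj] .
  show "card A \<le> d ^ n"
    using card_image[OF inj] card_mono[OF L(1) im] L(2) by simp
qed

lemma Fix_mod: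
  assumes "x \<in> Fix d n"
  shows "x i = x (i mod n)"
proof (induction i rule: less_induct)
  case (less i)
  show ?case
  proof (cases "i < n \<or> n = 0")
    case False
    have "x i = (shift ^^ n) x (i - n)"
      using False by (simp add: funpow_shift)
    also have "\<dots> = x (i - n)"
      using assms by (simp add: Fix_def)
    also have "\<dots> = x ((i - n) mod n)"
      using False by (intro less.IH) simp
    finally show ?thesis
      using False by (simp add: le_mod_geq)
  qed auto
qed

lemma Fix_eqI:
  assumes "x \<in> Fix d n" "y \<in> Fix d n" "n > 0" "\<And>i. i < n \<Longrightarrow> x i = y i"
  shows "x = y"
proof
  fix i
  show "x i = y i"
    using Fix_mod[OF assms(1), of i] Fix_mod[OF assms(2), of i] assms(3,4) by simp
qed

lemma inj_on_prefix_Fix: "n > 0 \<Longrightarrow> inj_on (\<lambda>x. map x [0..<n]) (Fix d n)"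
  by (rule inj_onI, rule Fix_eqI) (auto simp: map_eq_conv)

lemma finite_Fix: "n > 0 \<Longrightarrow> finite (Fix d n)"
  and card_Fix_le: "n > 0 \<Longrightarrow> card (Fix d n) \<le> d ^ n"
  using card_le_if_inj_on_prefix[OF subsetI[OF Fix_in_full_shift] inj_on_prefix_Fix] by auto

text \<open>Distinct points of \<open>Fix d n\<close> differ in one of the first \<open>n\<close> symbols, and points with
  different first symbols have distance \<open>1\<close>.\<close>

lemma dyn_separated_Fix:
  assumes theta: "0 < \<theta>" "\<theta> < 1" and n: "n > 0" and \<epsilon>: "\<epsilon> < 1"
  shows "dyn_separated (shift_metric d \<theta>) shift n \<epsilon> (Fix d n)"
  unfolding dyn_separated_def shift_metric_simps[OF theta]
proof (intro conjI ballI impI)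
  show "finite (Fix d n)" "Fix d n \<subseteq> full_shift d"
    using finite_Fix[OF n] Fix_in_full_shift by auto
  fix x y assume xy: "x \<in> Fix d n" "y \<in> Fix d n" "x \<noteq> y"
  obtain i where i: "i < n" "x i \<noteq> y i"
    using Fix_eqI[OF xy(1,2) n] xy(3) by blast
  then have "\<not> theta_dist \<theta> ((shift ^^ i) x) ((shift ^^ i) y) < \<theta> ^ 0"
    unfolding theta_dist_less_iff[OF theta] by (simp add: funpow_shift)
  then show "\<exists>i<n. \<epsilon> < theta_dist \<theta> ((shift ^^ i) x) ((shift ^^ i) y)"
    using i(1) \<epsilon> by (intro exI[of _ i]) simp
qed

text \<open>Points with the same \<open>n + k\<close> symbols agree, at each time
  \<open>i < n\<close>, on the symbols 0 to \<open>k\<close>, since \<open>i + k < n + k\<close>.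
  Their iterates are then closer than \<open>\<theta> ^ k\<close>, so a separated set is determined
  by its prefixes.\<close>

lemma dyn_separated_card_le:
  assumes theta: "0 < \<theta>" "\<theta> < 1" and k: "\<theta> ^ k \<le> \<epsilon>"
    and E: "dyn_separated (shift_metric d \<theta>) shift n \<epsilon> E"
  shows "card E \<le> d ^ (n + k)"
proof (rule card_le_if_inj_on_prefix)
  note E' = E[unfolded dyn_separated_def shift_metric_simps[OF theta]]
  show "E \<subseteq> full_shift d"
    using E' by blast
  show "inj_on (\<lambda>x. map x [0..<n + k]) E"
  proof (rule inj_onI, rule ccontr)
    fix x y assume xy: "x \<in> E" "y \<in> E" "map x [0..<n + k] = map y [0..<n + k]" "x \<noteq> y"
    obtain i where i: "i < n" "theta_dist \<theta> ((shift ^^ i) x) ((shift ^^ i) y) > \<epsilon>"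
      using E' xy(1,2,4) by metis
    have "(shift ^^ i) x j = (shift ^^ i) y j" if "j \<le> k" for j
      using xy(3) i(1) that by (simp add: funpow_shift)
    then have "theta_dist \<theta> ((shift ^^ i) x) ((shift ^^ i) y) < \<theta> ^ k"
      using theta_dist_less_iff[OF theta] by blast
    then show False using i(2) k by simp
  qed
qed

text \<open>\<open>A\<close> stands for the maximal average, to be used as
  \<open>c * \<beta>\<close> for the potential \<open>c f\<close>. One good point per length is
  enough below because a singleton is separated; above, \<open>A + C / n\<close> bounds every
  average of positive length \<open>n\<close> and counting contributes \<open>ln d\<close>.\<close>

locale bounded_birkhoff_potential =
  fixes d :: nat and \<theta> :: real and \<phi> :: "(nat \<Rightarrow> nat) \<Rightarrow> real" and A C :: real
  assumes d: "d \<ge> 1" and theta: "0 < \<theta>" "\<theta> < 1"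
    and upper: "\<And>n x. x \<in> full_shift d \<Longrightarrow> birkhoff_sum shift \<phi> n x \<le> real n * A + C"
    and lower: "\<And>n. \<exists>x\<in>full_shift d. birkhoff_sum shift \<phi> n x \<ge> real n * A"
begin

abbreviation Z :: "real \<Rightarrow> nat \<Rightarrow> real" where
  "Z \<epsilon> n \<equiv> partition_sum (shift_metric d \<theta>) shift \<phi> n \<epsilon>"

abbreviation separated :: "nat \<Rightarrow> real \<Rightarrow> (nat \<Rightarrow> nat) set \<Rightarrow> bool" where
  "separated \<equiv> dyn_separated (shift_metric d \<theta>) shift"

lemma sum_separated_le:
  assumes "\<theta> ^ k \<le> \<epsilon>" "separated n \<epsilon> E"
  shows "(\<Sum>x\<in>E. exp (birkhoff_sum shift \<phi> n x)) \<le> real d ^ (n + k) * exp (real n * A + C)"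
proof -
  have "x \<in> full_shift d" if "x \<in> E" for x
    using assms(2) that by (auto simp: dyn_separated_def shift_metric_simps[OF theta])
  then have "(\<Sum>x\<in>E. exp (birkhoff_sum shift \<phi> n x)) \<le> real (card E) * exp (real n * A + C)"
    using upper by (intro sum_bounded_above) simp
  also have "\<dots> \<le> real (d ^ (n + k)) * exp (real n * A + C)"
    using dyn_separated_card_le[OF theta assms] by (intro mult_right_mono) (simp_all only: of_nat_le_iff, simp)
  finally show ?thesis by simp
qed

lemma theta_power_le:
  assumes "\<epsilon> > 0"
  obtains k where "\<theta> ^ k \<le> \<epsilon>"
  using real_arch_pow_inv[OF assms theta(2)] less_imp_le by blast

lemma bdd_above_separated_sums:
  assumes "\<epsilon> > 0"
  shows "bdd_above ((\<lambda>E. \<Sum>x\<in>E. exp (birkhoff_sum shift \<phi> n x)) ` {E. separated n \<epsilon> E})"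
proof -
  obtain k where "\<theta> ^ k \<le> \<epsilon>"
    using theta_power_le[OF assms] .
  then show ?thesis
    using sum_separated_le by (intro bdd_aboveI2[where M = "real d ^ (n + k) * exp (real n * A + C)"]) simp
qed

lemma partition_sum_upper:
  assumes "\<epsilon> > 0" "separated n \<epsilon> E"
  shows "(\<Sum>x\<in>E. exp (birkhoff_sum shift \<phi> n x)) \<le> Z \<epsilon> n"
  unfolding partition_sum_def
  using assms by (intro cSUP_upper bdd_above_separated_sums) auto

lemma separated_empty: "separated n \<epsilon> {}"
  by (simp add: dyn_separated_def)

lemma partition_sum_le:
  assumes "\<theta> ^ k \<le> \<epsilon>"
  shows "Z \<epsilon> n \<le> real d ^ (n + k) * exp (real n * A + C)"
  unfolding partition_sum_def
proof (rule cSUP_least)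
  show "{E. separated n \<epsilon> E} \<noteq> {}"
    using separated_empty by blast
qed (use sum_separated_le[OF assms] in simp)

lemma partition_sum_ge:
  assumes "\<epsilon> > 0"
  shows "exp (real n * A) \<le> Z \<epsilon> n"
proof -
  obtain x where x: "x \<in> full_shift d" "birkhoff_sum shift \<phi> n x \<ge> real n * A"
    using lower by blast
  then have "separated n \<epsilon> {x}"
    by (simp add: dyn_separated_def shift_metric_simps[OF theta])
  from partition_sum_upper[OF assms this] show ?thesis
    using x(2) by (simp add: order_trans[rotated])
qed

lemma partition_sum_pos: "\<epsilon> > 0 \<Longrightarrow> Z \<epsilon> n > 0"
  using partition_sum_ge[of \<epsilon> n] by (meson exp_gt_zero less_le_trans)

lemma partition_sum_antimono:
  assumes "0 < \<epsilon>" "\<epsilon> \<le> \<epsilon>'"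
  shows "Z \<epsilon>' n \<le> Z \<epsilon> n"
  unfolding partition_sum_def
proof (rule cSUP_subset_mono)
  show "{E. separated n \<epsilon>' E} \<noteq> {}"
    using separated_empty by blast
  show "{E. separated n \<epsilon>' E} \<subseteq> {E. separated n \<epsilon> E}"
    using le_less_trans[OF assms(2)] by (simp add: dyn_separated_def subset_iff) metis
qed (use bdd_above_separated_sums[OF assms(1)] in auto)

definition growth :: "real \<Rightarrow> ereal" where
  "growth \<epsilon> = limsup (\<lambda>n. ereal (ln (Z \<epsilon> n) / real n))"

lemma growth_antimono:
  assumes "0 < \<epsilon>" "\<epsilon> \<le> \<epsilon>'"
  shows "growth \<epsilon>' \<le> growth \<epsilon>"
  unfolding growth_def
proof (intro Limsup_mono always_eventually allI)
  fix n
  have "ln (Z \<epsilon>' n) \<le> ln (Z \<epsilon> n)"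
    using partition_sum_antimono[OF assms] partition_sum_pos assms by (subst ln_le_cancel_iff) auto
  then show "ereal (ln (Z \<epsilon>' n) / real n) \<le> ereal (ln (Z \<epsilon> n) / real n)"
    by (simp add: divide_right_mono)
qed

text \<open>The scale costs \<open>k\<close> extra symbols, and distortion costs \<open>C\<close>;
  both are divided by \<open>n\<close> and vanish in the limit, so the bound is uniform in
  \<open>\<epsilon>\<close>.\<close>

lemma growth_le:
  assumes "\<epsilon> > 0"
  shows "growth \<epsilon> \<le> ereal (A + ln (real d))"
proof -
  obtain k where k: "\<theta> ^ k \<le> \<epsilon>"
    using theta_power_le[OF assms] .
  have "growth \<epsilon> \<le> limsup (\<lambda>n. ereal (A + ln (real d) + (real k * ln (real d) + C) / real n))"
    unfolding growth_def
  proof (rule Limsup_mono, rule eventually_mono[OF eventually_gt_at_top[of 0]])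
    fix n :: nat assume n: "0 < n"
    have "ln (Z \<epsilon> n) \<le> ln (real d ^ (n + k) * exp (real n * A + C))"
      using partition_sum_le[OF k] partition_sum_pos[OF assms] d
      by (subst ln_le_cancel_iff) auto
    also have "\<dots> = real (n + k) * ln (real d) + (real n * A + C)"
      using d by (simp add: ln_mult ln_realpow)
    finally show "ereal (ln (Z \<epsilon> n) / real n) \<le>
        ereal (A + ln (real d) + (real k * ln (real d) + C) / real n)"
      using n by (simp add: field_simps)
  qed
  also have "limsup (\<lambda>n. ereal (A + ln (real d) + (real k * ln (real d) + C) / real n)) =
      ereal (A + ln (real d))"
  proof (rule lim_imp_Limsup)
    have "(\<lambda>n. A + ln (real d) + (real k * ln (real d) + C) / real n) \<longlonglongrightarrow> A + ln (real d) + 0"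
      by (intro tendsto_intros lim_const_over_n)
    then show "(\<lambda>n. ereal (A + ln (real d) + (real k * ln (real d) + C) / real n))
        \<longlonglongrightarrow> ereal (A + ln (real d))"
      by simp
  qed simp
  finally show ?thesis .
qed

lemma growth_ge:
  assumes "\<epsilon> > 0"
  shows "ereal A \<le> growth \<epsilon>"
proof -
  have "limsup (\<lambda>n::nat. ereal A) \<le> growth \<epsilon>"
    unfolding growth_def
  proof (rule Limsup_mono, rule eventually_mono[OF eventually_gt_at_top[of 0]])
    fix n :: nat assume n: "0 < n"
    have "real n * A \<le> ln (Z \<epsilon> n)"
      using partition_sum_ge[OF assms, of n] partition_sum_pos[OF assms, of n] by (simp add: ln_ge_iff)
    then show "ereal A \<le> ereal (ln (Z \<epsilon> n) / real n)"
      using n by (simp add: field_simps)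
  qed
  then show ?thesis by (simp add: Limsup_const)
qed

text \<open>\<open>Lim\<close> can be evaluated only once convergence is established. Refining the
  scale increases \<open>growth\<close>, so it converges to its supremum.\<close>

lemma top_pressure_eq: "top_pressure (shift_metric d \<theta>) shift \<phi> = (SUP \<epsilon>\<in>{0<..}. growth \<epsilon>)"
proof -
  let ?G = "SUP \<epsilon>\<in>{0<..}. growth \<epsilon>"
  have "(growth \<longlongrightarrow> ?G) (at_right 0)"
  proof (rule order_tendstoI)
    fix a assume "a < ?G"
    then obtain \<epsilon>0 where \<epsilon>0: "\<epsilon>0 > 0" "a < growth \<epsilon>0"
      by (auto simp: less_SUP_iff)
    have "a < growth \<epsilon>" if "0 < \<epsilon>" "\<epsilon> < \<epsilon>0" for \<epsilon>
      using that growth_antimono[of \<epsilon> \<epsilon>0] \<epsilon>0(2) by auto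
    then show "\<forall>\<^sub>F \<epsilon> in at_right 0. a < growth \<epsilon>"
      using \<epsilon>0(1) by (auto simp: eventually_at_right_field)
  next
    fix a assume "?G < a"
    then have "growth \<epsilon> < a" if "0 < \<epsilon>" for \<epsilon>
      using that by (intro le_less_trans[OF SUP_upper[of \<epsilon>]]) auto
    then show "\<forall>\<^sub>F \<epsilon> in at_right 0. growth \<epsilon> < a"
      by (auto simp: eventually_at_right_field intro!: exI[of _ 1])
  qed
  then have "Lim (at_right 0) growth = ?G"
    by (rule tendsto_Lim[OF trivial_limit_at_right_real])
  moreover have "growth = (\<lambda>\<epsilon>. limsup (\<lambda>n. ereal (ln (Z \<epsilon> n) / real n)))"
    by (rule ext) (rule growth_def)
  ultimately show ?thesis
    by (simp only: top_pressure_def)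
qed

text \<open>The conversion to a real number is faithful because the supremum lies between two real
  bounds.\<close>

lemma ereal_pressure: "ereal (pressure d \<theta> \<phi>) = (SUP \<epsilon>\<in>{0<..}. growth \<epsilon>)"
proof -
  have "(SUP \<epsilon>\<in>{0<..}. growth \<epsilon>) \<le> ereal (A + ln (real d))"
    using growth_le by (intro SUP_least) auto
  moreover have "ereal A \<le> (SUP \<epsilon>\<in>{0<..}. growth \<epsilon>)"
    using growth_ge[of 1] by (intro SUP_upper2[of 1]) auto
  ultimately show ?thesis
    unfolding pressure_def top_pressure_eq by (intro ereal_real') (auto simp: abs_ereal_ge0)
qed

lemma pressure_le: "pressure d \<theta> \<phi> \<le> A + ln (real d)"
proof -
  have "ereal (pressure d \<theta> \<phi>) \<le> ereal (A + ln (real d))"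
    unfolding ereal_pressure using growth_le by (intro SUP_least) auto
  then show ?thesis by simp
qed

lemma pressure_ge: "A \<le> pressure d \<theta> \<phi>"
proof -
  have "ereal A \<le> ereal (pressure d \<theta> \<phi>)"
    unfolding ereal_pressure using growth_ge[of 1] by (intro SUP_upper2[of 1]) auto
  then show ?thesis by simp
qed

text \<open>Periodic points are separated at scale 1/2, and the growth at a single scale is at most
  the pressure. The margin \<open>\<eta>\<close> turns the limsup into an eventual bound.\<close>

lemma eventually_sum_Fix_le:
  assumes "\<eta> > 0"
  shows "\<forall>\<^sub>F n in sequentially.
    (\<Sum>x\<in>Fix d n. exp (birkhoff_sum shift \<phi> n x)) \<le> exp (real n * (pressure d \<theta> \<phi> + \<eta>))"
proof -
  have "growth (1/2) \<le> ereal (pressure d \<theta> \<phi>)"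
    unfolding ereal_pressure by (intro SUP_upper) simp
  also have "\<dots> < ereal (pressure d \<theta> \<phi> + \<eta>)"
    using assms by simp
  finally have "\<forall>\<^sub>F n in sequentially. ereal (ln (Z (1/2) n) / real n) < ereal (pressure d \<theta> \<phi> + \<eta>)"
    unfolding growth_def by (rule Limsup_lessD)
  then show ?thesis
    using eventually_gt_at_top[of 0]
  proof eventually_elim
    case (elim n)
    have "(\<Sum>x\<in>Fix d n. exp (birkhoff_sum shift \<phi> n x)) \<le> Z (1/2) n"
      by (intro partition_sum_upper dyn_separated_Fix theta elim) auto
    also have "\<dots> = exp (ln (Z (1/2) n))"
      using partition_sum_pos[of "1/2" n] by simp
    also have "\<dots> \<le> exp (real n * (pressure d \<theta> \<phi> + \<eta>))"
      using elim by (simp add: field_simps)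
    finally show ?case .
  qed
qed

end

section \<open>The measures built from periodic points\<close>

locale positive_lipschitz_potential = lipschitz_potential +
  assumes pos: "\<And>x. x \<in> full_shift d \<Longrightarrow> f x > 0"
begin

lemma max_value_nonneg: "\<beta> \<ge> 0"
proof -
  have "S 1 (\<lambda>_. 1) \<le> real 1 * \<beta>"
    using birkhoff_sum_Fix_le[OF d cont const_in_Fix[OF d]] .
  then show ?thesis
    using pos[OF const_in_full_shift[OF d]] by (simp add: birkhoff_sum_def)
qed

lemma birkhoff_sum_nonneg:
  assumes "x \<in> full_shift d"
  shows "S n x \<ge> 0"
  unfolding birkhoff_sum_def
  using pos[OF funpow_shift_in_full_shift[OF assms]] by (intro sum_nonneg) (simp add: less_imp_le)

text \<open>Compactness turns pointwise positivity into a positive minimum, which is what makes the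
  series converge for \<open>s < 1\<close>.\<close>

lemma birkhoff_sum_linear_lower:
  obtains m where "m > 0" "\<And>n x. x \<in> full_shift d \<Longrightarrow> S n x \<ge> real n * m"
proof -
  obtain z where z: "z \<in> full_shift d" "\<And>x. x \<in> full_shift d \<Longrightarrow> f z \<le> f x"
    using continuous_attains_inf[OF compact_full_shift _ cont] const_in_full_shift[OF d] by blast
  have "S n x \<ge> real n * f z" if x: "x \<in> full_shift d" for n x
    using sum_bounded_below[of "{..<n}" "f z" "\<lambda>i. f ((shift ^^ i) x)"]
      z(2)[OF funpow_shift_in_full_shift[OF x]] by (simp add: birkhoff_sum_def)
  then show thesis
    using that[OF pos[OF z(1)]] by blast
qed

abbreviation P :: "real \<Rightarrow> real" where "P c \<equiv> pressure d \<theta> (\<lambda>y. c * f y)"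

lemma bounded_birkhoff_potential:
  assumes "c \<ge> 0"
  shows "bounded_birkhoff_potential d \<theta> (\<lambda>y. c * f y) (c * \<beta>) (c * (B / (1 - \<theta>)))"
proof
  fix n x assume "x \<in> full_shift d"
  then have "c * S n x \<le> c * (real n * \<beta> + B / (1 - \<theta>))"
    using assms birkhoff_sum_le by (intro mult_left_mono)
  then show "birkhoff_sum shift (\<lambda>y. c * f y) n x \<le> real n * (c * \<beta>) + c * (B / (1 - \<theta>))"
    by (simp add: birkhoff_sum_cmult algebra_simps)
next
  fix n
  obtain x where "x \<in> full_shift d" "S n x \<ge> real n * \<beta>"
    using birkhoff_sum_ge_max_value[OF d cont] .
  then show "\<exists>x\<in>full_shift d. real n * (c * \<beta>) \<le> birkhoff_sum shift (\<lambda>y. c * f y) n x"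
    using assms mult_left_mono[of "real n * \<beta>" "S n x" c]
    by (intro bexI[of _ x]) (simp_all add: birkhoff_sum_cmult algebra_simps)
qed (use d theta in auto)

lemma pressure_bounds:
  assumes "c \<ge> 0"
  shows "c * \<beta> \<le> P c" "P c \<le> c * \<beta> + ln (real d)"
proof -
  interpret bounded_birkhoff_potential d \<theta> "\<lambda>y. c * f y" "c * \<beta>" "c * (B / (1 - \<theta>))"
    by (rule bounded_birkhoff_potential[OF assms])
  show "c * \<beta> \<le> P c" "P c \<le> c * \<beta> + ln (real d)"
    by (rule pressure_ge, rule pressure_le)
qed

abbreviation weight :: "real \<Rightarrow> real \<Rightarrow> nat \<Rightarrow> (nat \<Rightarrow> nat) \<Rightarrow> real" where
  "weight \<equiv> periodic_weight d \<theta> f"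

definition mass :: "real \<Rightarrow> real \<Rightarrow> nat \<Rightarrow> real" where
  "mass c s n = (\<Sum>x\<in>Fix d (Suc n). weight c s (Suc n) x)"

definition moment :: "real \<Rightarrow> real \<Rightarrow> ((nat \<Rightarrow> nat) \<Rightarrow> real) \<Rightarrow> nat \<Rightarrow> real" where
  "moment c s g n =
     (\<Sum>x\<in>Fix d (Suc n). weight c s (Suc n) x * (birkhoff_sum shift g (Suc n) x / real (Suc n)))"

lemma periodic_average_eq: "periodic_average d \<theta> f c s g = (\<Sum>n. moment c s g n) / (\<Sum>n. mass c s n)"
  by (simp add: periodic_average_def moment_def mass_def)

lemma weight_pos: "weight c s n x > 0"
  by (simp add: periodic_weight_def)

lemma mass_pos: "mass c s n > 0"
  unfolding mass_def using finite_Fix[of "Suc n" d] const_in_Fix[OF d, of "Suc n"] weight_pos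
  by (intro sum_pos) auto

text \<open>Replacing \<open>c\<close> by \<open>c s\<close> gains the factor \<open>exp (- c (1 - s) S n x)\<close>, which decays
  exponentially in \<open>n\<close> because \<open>f\<close> is bounded below by a positive constant.\<close>

lemma summable_mass:
  assumes c: "c > 0" and s: "s < 1"
  shows "summable (mass c s)"
proof -
  interpret bounded_birkhoff_potential d \<theta> "\<lambda>y. c * f y" "c * \<beta>" "c * (B / (1 - \<theta>))"
    using c by (intro bounded_birkhoff_potential) simp
  obtain m where m: "m > 0" "\<And>n x. x \<in> full_shift d \<Longrightarrow> S n x \<ge> real n * m"
    using birkhoff_sum_linear_lower by blast
  \<comment> \<open>Half of the guaranteed gain \<open>c * (1 - s) * m\<close> per symbol absorbs
    the margin in the growth of the periodic sums; the other half remains as the rate of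
    decay.\<close>
  define \<eta> where "\<eta> = c * (1 - s) * m / 2"
  have \<eta>: "\<eta> > 0"
    using c s m(1) by (simp add: \<eta>_def)
  have weight_le: "weight c s n x \<le> exp (c * S n x) * exp (- real n * (P c + 2 * \<eta>))"
    if "x \<in> Fix d n" for n x
  proof -
    have "c * (1 - s) * (real n * m) \<le> c * (1 - s) * S n x"
      using c s m(2)[OF Fix_in_full_shift[OF that]] by (intro mult_left_mono) auto
    moreover have "2 * \<eta> = c * (1 - s) * m"
      by (simp add: \<eta>_def)
    ultimately have "c * s * S n x - real n * P c \<le> c * S n x + (- real n * (P c + 2 * \<eta>))"
      by (simp only:) (simp add: algebra_simps)
    then show ?thesis
      unfolding periodic_weight_def exp_add[symmetric] by simp
  qed
  have "\<forall>\<^sub>F n in sequentially. (\<Sum>x\<in>Fix d (Suc n). exp (c * S (Suc n) x)) \<le>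
      exp (real (Suc n) * (P c + \<eta>))"
    using eventually_sum_Fix_le[OF \<eta>] unfolding birkhoff_sum_cmult
    by (subst eventually_sequentially_Suc)
  then have "\<forall>\<^sub>F n in sequentially. norm (mass c s n) \<le> exp (- \<eta>) ^ Suc n"
  proof eventually_elim
    case (elim n)
    have "mass c s n \<le> (\<Sum>x\<in>Fix d (Suc n). exp (c * S (Suc n) x) * exp (- real (Suc n) * (P c + 2 * \<eta>)))"
      unfolding mass_def using weight_le by (intro sum_mono)
    also have "\<dots> = (\<Sum>x\<in>Fix d (Suc n). exp (c * S (Suc n) x)) * exp (- real (Suc n) * (P c + 2 * \<eta>))"
      by (rule sum_distrib_right[symmetric])
    also have "\<dots> \<le> exp (real (Suc n) * (P c + \<eta>)) * exp (- real (Suc n) * (P c + 2 * \<eta>))"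
      using elim by (intro mult_right_mono) auto
    also have "\<dots> = exp (real (Suc n) * (- \<eta>))"
      unfolding exp_add[symmetric] by (simp add: algebra_simps)
    also have "\<dots> = exp (- \<eta>) ^ Suc n"
      by (rule exp_of_nat_mult)
    finally show ?case
      using mass_pos[of c s n] by simp
  qed
  moreover have "summable (\<lambda>n. exp (- \<eta>) ^ Suc n)"
    using \<eta> by (subst summable_Suc_iff) (simp add: summable_geometric)
  ultimately show ?thesis
    by (rule summable_comparison_test_ev)
qed

lemma suminf_mass_pos:
  assumes "c > 0" "s < 1"
  shows "(\<Sum>n. mass c s n) > 0"
  using suminf_pos[OF summable_mass[OF assms]] mass_pos by blast

lemma summable_moment:
  assumes "c > 0" "s < 1" and g: "continuous_on (full_shift d) g"
  shows "summable (moment c s g)"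
proof -
  obtain M where M: "\<And>x. x \<in> full_shift d \<Longrightarrow> \<bar>g x\<bar> \<le> M"
    using continuous_on_full_shift_bounded[OF g] by metis
  show ?thesis
  proof (rule summable_comparison_test')
    show "summable (\<lambda>n. mass c s n * M)"
      by (intro summable_mult2 summable_mass assms)
    fix n
    have "\<bar>weight c s (Suc n) x * (birkhoff_sum shift g (Suc n) x / real (Suc n))\<bar> \<le>
        weight c s (Suc n) x * M" if "x \<in> Fix d (Suc n)" for x
    proof -
      have "\<bar>birkhoff_sum shift g (Suc n) x\<bar> \<le> (\<Sum>i<Suc n. \<bar>g ((shift ^^ i) x)\<bar>)"
        unfolding birkhoff_sum_def by (rule sum_abs)
      also have "\<dots> \<le> real (card {..<Suc n}) * M"
        using M[OF funpow_shift_in_full_shift[OF Fix_in_full_shift[OF that]]]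
        by (intro sum_bounded_above) simp
      finally have "\<bar>birkhoff_sum shift g (Suc n) x / real (Suc n)\<bar> \<le> M"
        by (simp add: field_simps)
      then show ?thesis
        unfolding abs_mult using weight_pos[of c s "Suc n" x] by (simp only: abs_of_pos mult_left_mono less_imp_le)
    qed
    then have "\<bar>moment c s g n\<bar> \<le> (\<Sum>x\<in>Fix d (Suc n). weight c s (Suc n) x * M)"
      unfolding moment_def by (intro order_trans[OF sum_abs] sum_mono)
    then show "norm (moment c s g n) \<le> mass c s n * M"
      by (simp add: mass_def sum_distrib_right)
  qed
qed

text \<open>The truncated series are integrals against finite mixtures of point masses; a weak* limit of
  these mixtures represents the full series.\<close>

lemma periodic_measure_exists:
  assumes c: "c > 0" and s: "s < 1"
  obtains \<nu> where "\<nu> \<in> invariant_measures d"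
    "\<And>g :: (nat \<Rightarrow> nat) \<Rightarrow> real. continuous_on (full_shift d) g \<Longrightarrow>
      (\<integral>x. g x \<partial>\<nu>) = periodic_average d \<theta> f c s g"
proof -
  \<comment> \<open>The index \<open>Suc K\<close> keeps every truncation nonempty, so that division
    by \<open>T K\<close> is legitimate already for \<open>K = 0\<close>.\<close>
  define T where "T K = (\<Sum>n<Suc K. mass c s n)" for K
  have T: "T K > 0" for K
    unfolding T_def using mass_pos by (intro sum_pos) auto
  \<comment> \<open>One index per term, periodic point and time along its orbit:
    \<open>birkhoff_sum\<close> divided by the period becomes a sum of equally weighted point
    masses.\<close>
  define I where "I K = (SIGMA n:{..<Suc K}. Fix d (Suc n) \<times> {..<Suc n})" for K
  define w where "w K = (\<lambda>(n, x, i :: nat). weight c s (Suc n) x / real (Suc n) / T K)" for K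
  define h where "h = (\<lambda>(n :: nat, x :: nat \<Rightarrow> nat, i). (shift ^^ i) x)"
  have sum_I: "(\<Sum>a\<in>I K. w K a * g (h a)) = (\<Sum>n<Suc K. moment c s g n) / T K" for K g
  proof -
    have "(\<Sum>a\<in>I K. w K a * g (h a)) = (\<Sum>n<Suc K. \<Sum>x\<in>Fix d (Suc n). \<Sum>i<Suc n.
        weight c s (Suc n) x / real (Suc n) / T K * g ((shift ^^ i) x))"
      unfolding I_def using finite_Fix
      by (simp add: sum.Sigma w_def h_def split_def del: of_nat_Suc sum.lessThan_Suc funpow.simps)
    also have "\<dots> = (\<Sum>n<Suc K. moment c s g n) / T K"
      unfolding moment_def birkhoff_sum_def sum_divide_distrib
      by (simp add: sum_distrib_left sum_divide_distrib mult_ac del: of_nat_Suc sum.lessThan_Suc funpow.simps)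
    finally show ?thesis .
  qed
  have moment_1: "moment c s (\<lambda>_. 1) n = mass c s n" for n
    by (simp add: moment_def mass_def birkhoff_sum_def del: of_nat_Suc)
  have "\<exists>\<nu>. \<nu> \<in> prob_measures d \<and> (\<forall>g :: (nat \<Rightarrow> nat) \<Rightarrow> real. continuous_on (full_shift d) g \<longrightarrow>
      (\<integral>x. g x \<partial>\<nu>) = (\<Sum>n<Suc K. moment c s g n) / T K)" for K
  proof -
    have "finite (I K)"
      unfolding I_def using finite_Fix by auto
    moreover have "w K a \<ge> 0" if "a \<in> I K" for a
      using T[of K] weight_pos by (auto simp: w_def split_def intro!: divide_nonneg_nonneg less_imp_le)
    moreover have "sum (w K) (I K) = 1"
      using sum_I[of K "\<lambda>_. 1"] T[of K] unfolding moment_1 by (simp add: T_def)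
    moreover have "h a \<in> full_shift d" if "a \<in> I K" for a
      using that by (auto simp: I_def h_def intro!: funpow_shift_in_full_shift dest: Fix_in_full_shift)
    ultimately show ?thesis
      using finite_mixture_exists[OF d, of "I K" "w K" h] unfolding sum_I by blast
  qed
  then have "\<exists>\<rho>. \<forall>K. \<rho> K \<in> prob_measures d \<and>
      (\<forall>g :: (nat \<Rightarrow> nat) \<Rightarrow> real. continuous_on (full_shift d) g \<longrightarrow>
        (\<integral>x. g x \<partial>\<rho> K) = (\<Sum>n<Suc K. moment c s g n) / T K)"
    by (intro choice allI)
  then obtain \<rho> where \<rho>: "\<And>K. \<rho> K \<in> prob_measures d"
    and int_\<rho>: "\<And>K (g :: (nat \<Rightarrow> nat) \<Rightarrow> real). continuous_on (full_shift d) g \<Longrightarrow>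
      (\<integral>x. g x \<partial>\<rho> K) = (\<Sum>n<Suc K. moment c s g n) / T K"
    by blast
  obtain r \<nu> where r: "strict_mono r" and lim: "weak_star_limit d (\<lambda>j. \<rho> (r j)) \<nu>"
    using prob_measures_weak_star_compact[OF d \<rho>] .
  have int: "(\<integral>x. g x \<partial>\<nu>) = periodic_average d \<theta> f c s g"
    if g: "continuous_on (full_shift d) g" for g :: "(nat \<Rightarrow> nat) \<Rightarrow> real"
  proof -
    have "(\<lambda>K. (\<Sum>n<Suc K. moment c s g n) / T K) \<longlonglongrightarrow> (\<Sum>n. moment c s g n) / (\<Sum>n. mass c s n)"
      unfolding T_def
      using suminf_mass_pos[OF c s]
      by (intro tendsto_divide LIMSEQ_Suc summable_LIMSEQ summable_mass summable_moment c s g) simp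
    from LIMSEQ_subseq_LIMSEQ[OF this r]
    have "(\<lambda>j. \<integral>x. g x \<partial>\<rho> (r j)) \<longlonglongrightarrow> periodic_average d \<theta> f c s g"
      unfolding int_\<rho>[OF g] periodic_average_eq by (simp add: comp_def)
    moreover have "(\<lambda>j. \<integral>x. g x \<partial>\<rho> (r j)) \<longlonglongrightarrow> (\<integral>x. g x \<partial>\<nu>)"
      using lim g unfolding weak_star_limit_def by blast
    ultimately show ?thesis
      using LIMSEQ_unique by blast
  qed
  have "\<nu> \<in> invariant_measures d"
  proof (rule invariant_measuresI[OF d])
    show "\<nu> \<in> prob_measures d"
      using lim by (simp add: weak_star_limit_def)
    fix g :: "(nat \<Rightarrow> nat) \<Rightarrow> real" assume g: "continuous_on (full_shift d) g"
    have "moment c s (\<lambda>x. g (shift x)) = moment c s g"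
      by (rule ext) (simp add: moment_def birkhoff_sum_comp_shift_Fix)
    then show "(\<integral>x. g (shift x) \<partial>\<nu>) = (\<integral>x. g x \<partial>\<nu>)"
      using int[OF g] int[OF continuous_on_comp_shift[OF g]] by (simp add: periodic_average_eq)
  qed
  then show thesis
    using int that by blast
qed

text \<open>The definite description is resolved by existence and by the fact that integrals of
  continuous functions determine a measure.\<close>

lemma periodic_measure:
  assumes "c > 0" "s < 1"
  shows "periodic_measure d \<theta> f c s \<in> invariant_measures d"
    and "continuous_on (full_shift d) g \<Longrightarrow>
      (\<integral>x. g x \<partial>periodic_measure d \<theta> f c s) = periodic_average d \<theta> f c s g"
proof -
  let ?Q = "\<lambda>\<nu>. \<nu> \<in> invariant_measures d \<and> (\<forall>g. continuous_on (full_shift d) g \<longrightarrow>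
    (\<integral>x. g x \<partial>\<nu>) = periodic_average d \<theta> f c s g)"
  obtain \<nu> where \<nu>: "?Q \<nu>"
    using periodic_measure_exists[OF assms] by blast
  have "?Q (THE \<nu>. ?Q \<nu>)"
  proof (rule theI[of ?Q, OF \<nu>])
    fix \<mu> assume \<mu>: "?Q \<mu>"
    show "\<mu> = \<nu>"
      using \<mu> \<nu> by (intro prob_measures_eqI[OF d]) (auto simp: invariant_measures_def)
  qed
  then show "periodic_measure d \<theta> f c s \<in> invariant_measures d"
    and "continuous_on (full_shift d) g \<Longrightarrow>
      (\<integral>x. g x \<partial>periodic_measure d \<theta> f c s) = periodic_average d \<theta> f c s g"
    unfolding periodic_measure_def by blast+
qed

end

section \<open>Zero-temperature limit\<close>

context positive_lipschitz_potential
begin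

text \<open>Either the defect is at most \<open>\<epsilon>\<close>, or the weight is exponentially
  small and the defect is at most \<open>\<beta>\<close> because \<open>S n x \<ge> 0\<close>.
  Adding both bounds gives one inequality for every point, so the sum over \<open>Fix d n\<close>
  need not be split. The exponential bound uses \<open>c * \<beta> \<le> P c\<close>,
  \<open>s < 1\<close> and \<open>\<beta> \<ge> 0\<close>.\<close>

lemma weight_defect_le:
  assumes c: "c > 0" and s: "0 < s" "s < 1" and \<epsilon>: "\<epsilon> > 0" and n: "n > 0" and x: "x \<in> Fix d n"
  shows "weight c s n x * (\<beta> - S n x / real n) \<le> \<epsilon> * weight c s n x + \<beta> * exp (- c * s * \<epsilon>) ^ n"
proof (cases "\<beta> - S n x / real n \<le> \<epsilon>")
  case True
  then have "weight c s n x * (\<beta> - S n x / real n) \<le> weight c s n x * \<epsilon>"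
    using weight_pos[of c s n x] by (intro mult_left_mono) auto
  also have "\<dots> = \<epsilon> * weight c s n x"
    by (rule mult.commute)
  also have "\<dots> \<le> \<epsilon> * weight c s n x + \<beta> * exp (- c * s * \<epsilon>) ^ n"
    using max_value_nonneg by simp
  finally show ?thesis .
next
  case False
  then have "S n x \<le> real n * (\<beta> - \<epsilon>)"
    using n by (simp add: field_simps)
  then have "c * s * S n x \<le> c * s * (real n * (\<beta> - \<epsilon>))"
    using c s by (intro mult_left_mono) auto
  moreover have "real n * (s * (c * \<beta>)) \<le> real n * (1 * (c * \<beta>))"
    using c s max_value_nonneg by (intro mult_left_mono mult_right_mono) auto
  moreover have "real n * (c * \<beta>) \<le> real n * P c"
    using pressure_bounds(1)[of c] c by (intro mult_left_mono) auto
  ultimately have "c * s * S n x - real n * P c \<le> real n * (- c * s * \<epsilon>)"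
    by (simp add: algebra_simps)
  then have w: "weight c s n x \<le> exp (- c * s * \<epsilon>) ^ n"
    unfolding periodic_weight_def exp_of_nat_mult[symmetric] by simp
  have "weight c s n x * (\<beta> - S n x / real n) \<le> weight c s n x * \<beta>"
    using birkhoff_sum_nonneg[OF Fix_in_full_shift[OF x], of n] weight_pos[of c s n x]
    by (intro mult_left_mono) auto
  also have "\<dots> \<le> exp (- c * s * \<epsilon>) ^ n * \<beta>"
    using w max_value_nonneg by (intro mult_right_mono)
  finally show ?thesis
    using weight_pos[of c s n x] \<epsilon> by (simp add: mult.commute add_increasing)
qed

text \<open>The number of periodic points is absorbed into the base of the power, which leaves a
  geometric series in the period.\<close>

lemma moment_defect_le:
  assumes c: "c > 0" and s: "0 < s" "s < 1" and \<epsilon>: "\<epsilon> > 0"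
  shows "\<beta> * mass c s n - moment c s f n \<le> \<epsilon> * mass c s n + \<beta> * (real d * exp (- c * s * \<epsilon>)) ^ Suc n"
proof -
  let ?F = "Fix d (Suc n)" and ?w = "weight c s (Suc n)" and ?q = "exp (- c * s * \<epsilon>) ^ Suc n"
  have "\<beta> * mass c s n - moment c s f n = (\<Sum>x\<in>?F. ?w x * (\<beta> - S (Suc n) x / real (Suc n)))"
    unfolding mass_def moment_def sum_distrib_left sum_subtractf[symmetric]
    by (intro sum.cong refl) (simp only: right_diff_distrib mult.commute)
  also have "\<dots> \<le> (\<Sum>x\<in>?F. \<epsilon> * ?w x + \<beta> * ?q)"
    by (intro sum_mono weight_defect_le assms) simp
  also have "\<dots> = \<epsilon> * mass c s n + real (card ?F) * (\<beta> * ?q)"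
    by (simp only: sum.distrib mass_def sum_distrib_left sum_constant)
  also have "\<dots> \<le> \<epsilon> * mass c s n + real (d ^ Suc n) * (\<beta> * ?q)"
    using card_Fix_le[of "Suc n" d] max_value_nonneg
    by (intro add_left_mono mult_right_mono) (simp_all only: of_nat_le_iff, simp_all)
  also have "\<dots> = \<epsilon> * mass c s n + \<beta> * (real d * exp (- c * s * \<epsilon>)) ^ Suc n"
    by (simp only: power_mult_distrib of_nat_power mult_ac)
  finally show ?thesis .
qed

lemma suminf_mass_ge:
  assumes c: "c > 0" and s: "0 < s" "s < 1" and N: "N > 0" and p: "p \<in> Fix d N"
    and S: "S N p \<ge> real N * \<beta> - \<eta>"
  shows "exp (- (c * (1 - s) * real N * \<beta> + c * s * \<eta> + real N * ln (real d))) \<le> (\<Sum>n. mass c s n)"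
proof -
  have "c * s * (real N * \<beta> - \<eta>) \<le> c * s * S N p"
    using S c s by (intro mult_left_mono) auto
  moreover have "real N * P c \<le> real N * (c * \<beta> + ln (real d))"
    using pressure_bounds(2)[of c] c by (intro mult_left_mono) auto
  ultimately have "exp (- (c * (1 - s) * real N * \<beta> + c * s * \<eta> + real N * ln (real d))) \<le> weight c s N p"
    unfolding periodic_weight_def by (simp add: algebra_simps)
  \<comment> \<open>Period \<open>N\<close> has index \<open>N - 1\<close> because
    \<open>mass\<close> is indexed from period 1.\<close>
  also have "\<dots> \<le> mass c s (N - 1)"
    unfolding mass_def using N p finite_Fix weight_pos
    by (intro order_trans[OF _ member_le_sum[of p]]) (auto intro: less_imp_le)
  also have "\<dots> = (\<Sum>n\<in>{N - 1}. mass c s n)"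
    by simp
  also have "\<dots> \<le> (\<Sum>n. mass c s n)"
    using mass_pos summable_mass[OF c s(2)] by (intro sum_le_suminf) (auto intro: less_imp_le)
  finally show ?thesis .
qed

text \<open>The defects are summed over all periods and divided by the total mass. A ratio of at
  most 1/2 bounds the geometric series by twice its first term, which is the factor 2 here.\<close>

lemma integral_defect_le:
  assumes c: "c > 0" and s: "0 < s" "s < 1" and \<epsilon>: "\<epsilon> > 0"
    and q: "real d * exp (- c * s * \<epsilon>) \<le> 1 / 2"
  shows "\<beta> - (\<integral>x. f x \<partial>periodic_measure d \<theta> f c s) \<le>
    \<epsilon> + 2 * \<beta> * (real d * exp (- c * s * \<epsilon>)) / (\<Sum>n. mass c s n)"
proof -
  let ?q = "real d * exp (- c * s * \<epsilon>)" and ?M = "\<Sum>n. mass c s n"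
  have M: "?M > 0"
    using suminf_mass_pos[OF c s(2)] .
  note sm = summable_mass[OF c s(2)] and sf = summable_moment[OF c s(2) cont]
  have q0: "?q \<ge> 0"
    by simp
  have sq: "summable (\<lambda>n. ?q ^ Suc n)"
    using q q0 by (subst summable_Suc_iff) (auto intro: summable_geometric)
  have "\<beta> * ?M - (\<Sum>n. moment c s f n) = (\<Sum>n. \<beta> * mass c s n - moment c s f n)"
    using suminf_diff[OF summable_mult[OF sm] sf] suminf_mult[OF sm] by simp
  also have "\<dots> \<le> (\<Sum>n. \<epsilon> * mass c s n + \<beta> * ?q ^ Suc n)"
    by (intro suminf_le moment_defect_le assms summable_diff summable_add summable_mult sm sf sq)
  also have "\<dots> = \<epsilon> * ?M + \<beta> * (\<Sum>n. ?q ^ Suc n)"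
    using suminf_add[OF summable_mult[OF sm] summable_mult[OF sq]] suminf_mult[OF sm] suminf_mult[OF sq]
    by simp
  also have "(\<Sum>n. ?q ^ Suc n) = ?q * (1 / (1 - ?q))"
    using q q0 suminf_mult[OF summable_geometric[of ?q], of ?q] suminf_geometric[of ?q] by simp
  also have "\<epsilon> * ?M + \<beta> * (?q * (1 / (1 - ?q))) \<le> \<epsilon> * ?M + \<beta> * (?q * 2)"
    using q q0 max_value_nonneg by (intro add_left_mono mult_left_mono) (auto simp: field_simps)
  finally have "(\<beta> * ?M - (\<Sum>n. moment c s f n)) / ?M \<le> (\<epsilon> * ?M + \<beta> * (?q * 2)) / ?M"
    using M by (intro divide_right_mono) auto
  then show ?thesis
    using M unfolding periodic_measure(2)[OF c s(2) cont] periodic_average_eq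
    by (simp add: diff_divide_distrib add_divide_distrib mult_ac)
qed

text \<open>\<open>N\<close> and \<open>p\<close> depend on \<open>\<epsilon>\<close> alone, so the
  thresholds for \<open>c\<close> and for \<open>s\<close> can be chosen independently, as the
  product filter requires; no relation between the two rates is imposed.\<close>

lemma integral_periodic_measure_near_max:
  assumes \<epsilon>: "\<epsilon> > 0"
  shows "\<forall>\<^sub>F (c, s) in at_top \<times>\<^sub>F at_left 1. \<beta> - (\<integral>x. f x \<partial>periodic_measure d \<theta> f c s) < 2 * \<epsilon>"
proof -
  obtain N p where Np: "N > 0" "p \<in> Fix d N" "S N p \<ge> real N * \<beta> - \<epsilon> / 4"
    using periodic_near_maximal[of "\<epsilon> / 4"] \<epsilon> by auto
  \<comment> \<open>Everything in the error term that is fixed once \<open>N\<close> is known,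
    including the cost \<open>N * ln d\<close> of using a single orbit.\<close>
  define K where "K = 2 * \<beta> * real d * exp (real N * ln (real d))"
  have exp_to_0: "((\<lambda>c. a * exp (- (b * c))) \<longlongrightarrow> a * 0) at_top" if "b > 0" for a b :: real
    using that
    by (intro tendsto_mult_left filterlim_compose[OF exp_at_bot] filterlim_compose[OF filterlim_uminus_at_bot_at_top]
        filterlim_tendsto_pos_mult_at_top[OF tendsto_const]) (auto simp: filterlim_ident)
  have "\<forall>\<^sub>F c in at_top. K * exp (- (\<epsilon> / 4 * c)) < \<epsilon>"
    using exp_to_0[of "\<epsilon> / 4" K] \<epsilon> by (intro order_tendstoD) auto
  moreover have "\<forall>\<^sub>F c in at_top. real d * exp (- (\<epsilon> / 2 * c)) < 1 / 2"
    using exp_to_0[of "\<epsilon> / 2" "real d"] \<epsilon> by (intro order_tendstoD) auto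
  ultimately have ev_c: "\<forall>\<^sub>F c in at_top. c > 0 \<and> K * exp (- (\<epsilon> / 4 * c)) < \<epsilon> \<and>
      real d * exp (- (\<epsilon> / 2 * c)) < 1 / 2"
    using eventually_gt_at_top[of 0] by eventually_elim auto
  have "((\<lambda>s. (1 - s) * real N * \<beta>) \<longlongrightarrow> (1 - 1) * real N * \<beta>) (at_left 1)"
    by (intro tendsto_intros)
  then have "\<forall>\<^sub>F s in at_left 1. (1 - s) * real N * \<beta> < \<epsilon> / 8"
    using \<epsilon> by (intro order_tendstoD) auto
  moreover have "\<forall>\<^sub>F s in at_left 1. s \<in> {1 / 2<..<1 :: real}"
    by (rule eventually_at_left_real) simp
  ultimately have ev_s: "\<forall>\<^sub>F s in at_left 1. 1 / 2 < s \<and> s < 1 \<and> (1 - s) * real N * \<beta> < \<epsilon> / 8"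
    by eventually_elim auto
  have "\<beta> - (\<integral>x. f x \<partial>periodic_measure d \<theta> f c s) < 2 * \<epsilon>"
    if c: "c > 0" "K * exp (- (\<epsilon> / 4 * c)) < \<epsilon>" "real d * exp (- (\<epsilon> / 2 * c)) < 1 / 2"
    and s: "1 / 2 < s" "s < 1" "(1 - s) * real N * \<beta> < \<epsilon> / 8" for c s
  proof -
    let ?q = "real d * exp (- c * s * \<epsilon>)" and ?M = "\<Sum>n. mass c s n"
    let ?E = "c * (1 - s) * real N * \<beta> + c * s * (\<epsilon> / 4) + real N * ln (real d)"
    have s0: "0 < s"
      using s by simp
    have half: "c * \<epsilon> * (1 / 2) \<le> c * \<epsilon> * s"
      using s c \<epsilon> by (intro mult_left_mono) auto
    have "?q \<le> real d * exp (- (\<epsilon> / 2 * c))"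
      using half by (intro mult_left_mono) (auto simp: mult_ac)
    then have q: "?q \<le> 1 / 2"
      using c(3) by simp
    have "c * ((1 - s) * real N * \<beta>) \<le> c * (\<epsilon> / 8)"
      using s c by (intro mult_left_mono) auto
    \<comment> \<open>The defect \<open>\<epsilon> / 4\<close> of \<open>p\<close> leaves
      \<open>- (3/4) * c * s * \<epsilon>\<close>, which is at most
      \<open>- (3/8) * c * \<epsilon>\<close> as \<open>s > 1/2\<close>. The term with
      \<open>1 - s\<close> gives back at most \<open>c * \<epsilon> / 8\<close>, whence the rate
      \<open>\<epsilon> / 4\<close>.\<close>
    then have expo: "- c * s * \<epsilon> + ?E \<le> - (\<epsilon> / 4 * c) + real N * ln (real d)"
      using half by (simp add: algebra_simps)
    have "2 * \<beta> * ?q / ?M \<le> 2 * \<beta> * ?q / exp (- ?E)"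
      using suminf_mass_ge[OF c(1) s0 s(2) Np] max_value_nonneg suminf_mass_pos[OF c(1) s(2)]
      by (intro divide_left_mono mult_nonneg_nonneg mult_pos_pos) auto
    also have "\<dots> = 2 * \<beta> * real d * exp (- c * s * \<epsilon> + ?E)"
      unfolding exp_add[of "- c * s * \<epsilon>" ?E] by (simp only: exp_minus divide_inverse inverse_inverse_eq mult_ac)
    also have "\<dots> \<le> 2 * \<beta> * real d * exp (- (\<epsilon> / 4 * c) + real N * ln (real d))"
      using expo max_value_nonneg by (intro mult_left_mono) auto
    also have "\<dots> = K * exp (- (\<epsilon> / 4 * c))"
      unfolding exp_add K_def by (simp only: mult_ac)
    finally have "2 * \<beta> * ?q / ?M < \<epsilon>"
      using c(2) by linarith
    then show ?thesis
      using integral_defect_le[OF c(1) s0 s(2) \<epsilon> q] by linarith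
  qed
  with ev_c ev_s show ?thesis
    unfolding eventually_prod_filter by (intro exI conjI) auto
qed

text \<open>The measures are invariant, so their integrals of \<open>f\<close> never exceed
  \<open>\<beta>\<close>; the estimate from below is all that convergence asks for.\<close>

lemma tendsto_integral_periodic_measure:
  "((\<lambda>(c, s). \<integral>x. f x \<partial>periodic_measure d \<theta> f c s) \<longlongrightarrow> \<beta>) (at_top \<times>\<^sub>F at_left 1)"
proof (rule tendstoI)
  fix e :: real assume e: "e > 0"
  have "\<forall>\<^sub>F c :: real in at_top. c > 0"
    by (rule eventually_gt_at_top)
  moreover have "\<forall>\<^sub>F s in at_left 1. s \<in> {0<..<1 :: real}"
    by (rule eventually_at_left_real) simp
  ultimately have "\<forall>\<^sub>F (c, s) in at_top \<times>\<^sub>F at_left (1 :: real). c > (0 :: real) \<and> s < 1"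
    unfolding eventually_prod_filter by fastforce
  moreover have "\<forall>\<^sub>F (c, s) in at_top \<times>\<^sub>F at_left 1. \<beta> - (\<integral>x. f x \<partial>periodic_measure d \<theta> f c s) < e"
    using integral_periodic_measure_near_max[of "e / 2"] e by simp
  ultimately show "\<forall>\<^sub>F cs in at_top \<times>\<^sub>F at_left 1.
      dist (case cs of (c, s) \<Rightarrow> \<integral>x. f x \<partial>periodic_measure d \<theta> f c s) \<beta> < e"
  proof eventually_elim
    case (elim cs)
    obtain c s where cs: "cs = (c, s)"
      by (cases cs)
    then show ?case
      using elim max_value_upper[OF cont periodic_measure(1)[of c s]] by (simp add: dist_real_def)
  qed
qed

section \<open>Accumulation points along parameter sequences\<close>

lemma admissible_seqs_filterlim:
  assumes "admissible_seqs c s"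
  shows "filterlim (\<lambda>j. (c j, s j)) (at_top \<times>\<^sub>F at_left 1) sequentially"
proof (rule filterlim_Pair)
  show "filterlim c at_top sequentially"
    using assms by (simp add: admissible_seqs_def)
  show "filterlim s (at_left 1) sequentially"
    using assms unfolding filterlim_at admissible_seqs_def by (auto intro!: always_eventually simp: less_imp_neq)
qed

lemma admissible_seqs_subseq:
  assumes "admissible_seqs c s" "strict_mono r"
  shows "admissible_seqs (\<lambda>j. c (r j)) (\<lambda>j. s (r j))"
  using assms filterlim_compose[OF _ filterlim_subseq[OF assms(2)], of c at_top]
    LIMSEQ_subseq_LIMSEQ[of s 1 r]
  by (simp add: admissible_seqs_def comp_def)

lemma periodic_measure_admissible:
  assumes "admissible_seqs c s"
  shows "periodic_measure d \<theta> f (c j) (s j) \<in> invariant_measures d"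
  using assms by (intro periodic_measure(1)) (auto simp: admissible_seqs_def)

text \<open>\<open>f\<close> is itself a continuous test function, so its integral passes to the
  weak* limit and must agree with the limit \<open>\<beta>\<close>.\<close>

lemma accumulation_point_maximizing:
  assumes "accumulation_point d \<theta> f \<mu>"
  shows "\<mu> \<in> max_measures d f"
proof -
  obtain c s where cs: "admissible_seqs c s"
    and lim: "weak_star_limit d (\<lambda>j. periodic_measure d \<theta> f (c j) (s j)) \<mu>"
    using assms unfolding accumulation_point_def by blast
  have "\<mu> \<in> invariant_measures d"
    using weak_star_limit_invariant[OF d periodic_measure_admissible[OF cs] lim] .
  moreover have "(\<lambda>j. \<integral>x. f x \<partial>periodic_measure d \<theta> f (c j) (s j)) \<longlonglongrightarrow> \<beta>"
    using filterlim_compose[OF tendsto_integral_periodic_measure admissible_seqs_filterlim[OF cs]] by simp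
  moreover have "(\<lambda>j. \<integral>x. f x \<partial>periodic_measure d \<theta> f (c j) (s j)) \<longlonglongrightarrow> (\<integral>x. f x \<partial>\<mu>)"
    using lim cont unfolding weak_star_limit_def by blast
  ultimately show ?thesis
    using LIMSEQ_unique unfolding max_measures_def by blast
qed

lemma admissible_seqs_accumulate:
  assumes cs: "admissible_seqs c s"
  obtains r \<mu> where "strict_mono r" "accumulation_point d \<theta> f \<mu>"
    "weak_star_limit d (\<lambda>j. periodic_measure d \<theta> f (c (r j)) (s (r j))) \<mu>"
proof -
  have "periodic_measure d \<theta> f (c j) (s j) \<in> prob_measures d" for j
    using periodic_measure_admissible[OF cs] by (simp add: invariant_measures_def)
  then obtain r \<mu> where r: "strict_mono r"
    and lim: "weak_star_limit d (\<lambda>j. periodic_measure d \<theta> f (c (r j)) (s (r j))) \<mu>"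
    by (rule prob_measures_weak_star_compact[OF d])
  have "accumulation_point d \<theta> f \<mu>"
    unfolding accumulation_point_def using admissible_seqs_subseq[OF cs r] lim by blast
  then show thesis
    using that[OF r] lim by blast
qed

text \<open>Compactness supplies an accumulation point along a subsequence, and the convergent
  integrals keep their limit on it.\<close>

lemma limit_is_accumulation_integral:
  fixes g :: "(nat \<Rightarrow> nat) \<Rightarrow> real"
  assumes g: "continuous_on (full_shift d) g" and cs: "admissible_seqs c s"
    and L: "(\<lambda>j. \<integral>x. g x \<partial>periodic_measure d \<theta> f (c j) (s j)) \<longlonglongrightarrow> L"
  shows "\<exists>\<mu>. accumulation_point d \<theta> f \<mu> \<and> L = (\<integral>x. g x \<partial>\<mu>)"
proof -
  obtain r \<mu> where r: "strict_mono r" and \<mu>: "accumulation_point d \<theta> f \<mu>"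
    and lim: "weak_star_limit d (\<lambda>j. periodic_measure d \<theta> f (c (r j)) (s (r j))) \<mu>"
    using admissible_seqs_accumulate[OF cs] .
  have "(\<lambda>j. \<integral>x. g x \<partial>periodic_measure d \<theta> f (c (r j)) (s (r j))) \<longlonglongrightarrow> L"
    using LIMSEQ_subseq_LIMSEQ[OF L r] by (simp add: comp_def)
  then show ?thesis
    using LIMSEQ_unique lim g \<mu> unfolding weak_star_limit_def by blast
qed

text \<open>If convergence failed, some admissible sequences would keep the integrals away from the
  claimed limit. Any accumulation point along them is maximizing, hence equal to
  \<open>\<mu>\<close>, a contradiction.\<close>

lemma tendsto_integral_of_unique_max:
  fixes g :: "(nat \<Rightarrow> nat) \<Rightarrow> real"
  assumes \<mu>: "max_measures d f = {\<mu>}" and g: "continuous_on (full_shift d) g"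
  shows "((\<lambda>(c, s). \<integral>x. g x \<partial>periodic_measure d \<theta> f c s) \<longlongrightarrow> (\<integral>x. g x \<partial>\<mu>)) (at_top \<times>\<^sub>F at_left 1)"
proof (rule ccontr)
  let ?F = "at_top \<times>\<^sub>F at_left (1 :: real) :: (real \<times> real) filter"
  let ?I = "\<lambda>c s. \<integral>x. g x \<partial>periodic_measure d \<theta> f c s"
  assume "\<not> ?thesis"
  then obtain e where e: "e > 0" and "\<not> (\<forall>\<^sub>F (c, s) in ?F. dist (?I c s) (\<integral>x. g x \<partial>\<mu>) < e)"
    unfolding tendsto_iff by (auto simp: split_def)
  \<comment> \<open>Failure along the product filter means that every rectangle of neighbourhoods
    contains a bad pair.\<close>
  then have freq: "\<exists>c s. Q c \<and> R s \<and> \<not> dist (?I c s) (\<integral>x. g x \<partial>\<mu>) < e"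
    if "\<forall>\<^sub>F c in at_top. Q c" "\<forall>\<^sub>F s in at_left 1. R s" for Q R
    using that unfolding eventually_prod_filter by auto
  \<comment> \<open>The \<open>j\<close>-th rectangle forces \<open>c j \<ge> j\<close> and
    \<open>s j\<close> within \<open>1 / (j + 1)\<close> of 1, so the chosen bad pairs form
    admissible sequences.\<close>
  have "\<exists>c s. (c > 0 \<and> c \<ge> real j) \<and> (s \<in> {0<..<1} \<and> s \<in> {1 - 1 / real (Suc j)<..<1}) \<and>
      \<not> dist (?I c s) (\<integral>x. g x \<partial>\<mu>) < e" for j
  proof (rule freq)
    show "\<forall>\<^sub>F c in at_top. c > 0 \<and> c \<ge> real j"
      by (intro eventually_conj eventually_gt_at_top eventually_ge_at_top)
    show "\<forall>\<^sub>F s in at_left 1. s \<in> {0<..<1} \<and> s \<in> {1 - 1 / real (Suc j)<..<1}"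
      by (intro eventually_conj eventually_at_left_real) simp_all
  qed
  then obtain c s where c: "\<And>j. c j > 0 \<and> c j \<ge> real j"
    and s: "\<And>j. s j \<in> {0<..<1} \<and> s j \<in> {1 - 1 / real (Suc j)<..<1}"
    and far: "\<And>j. \<not> dist (?I (c j) (s j)) (\<integral>x. g x \<partial>\<mu>) < e"
    by metis
  have "filterlim c at_top sequentially"
    using c by (intro filterlim_at_top_mono[OF filterlim_real_sequentially]) auto
  moreover have "s \<longlonglongrightarrow> 1"
  proof (rule tendsto_sandwich)
    show "(\<lambda>j. 1 - 1 / real (Suc j)) \<longlonglongrightarrow> 1"
      using tendsto_diff[OF tendsto_const LIMSEQ_Suc[OF lim_const_over_n[of 1]]] by simp
    show "\<forall>\<^sub>F j in sequentially. 1 - 1 / real (Suc j) \<le> s j" "\<forall>\<^sub>F j in sequentially. s j \<le> 1"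
      using s by (auto intro!: always_eventually simp: less_imp_le)
  qed simp
  ultimately have cs: "admissible_seqs c s"
    using c s by (simp add: admissible_seqs_def)
  obtain r \<mu>' where \<mu>': "accumulation_point d \<theta> f \<mu>'"
    and lim: "weak_star_limit d (\<lambda>j. periodic_measure d \<theta> f (c (r j)) (s (r j))) \<mu>'"
    using admissible_seqs_accumulate[OF cs] .
  have "\<mu>' = \<mu>"
    using accumulation_point_maximizing[OF \<mu>'] \<mu> by simp
  then have "\<forall>\<^sub>F j in sequentially. dist (?I (c (r j)) (s (r j))) (\<integral>x. g x \<partial>\<mu>) < e"
    using lim g tendstoD[OF _ e] unfolding weak_star_limit_def by blast
  then show False
    using far by simp
qed

end

theorem theorem3:
  fixes d :: nat and \<theta> :: real and f :: "(nat \<Rightarrow> nat) \<Rightarrow> real"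
  assumes d: "d \<ge> 1"
    and theta: "0 < \<theta>" "\<theta> < 1"
    and lip: "Lipschitz_continuous_map (shift_metric d \<theta>) euclidean_metric f"
    and pos: "\<And>x. x \<in> full_shift d \<Longrightarrow> f x > 0"
  shows "(\<forall>\<mu>. accumulation_point d \<theta> f \<mu> \<longrightarrow> \<mu> \<in> max_measures d f) \<and>
    (\<forall>(g :: (nat \<Rightarrow> nat) \<Rightarrow> real) c s L. continuous_on (full_shift d) g \<longrightarrow> admissible_seqs c s \<longrightarrow>
       (\<lambda>j. \<integral>x. g x \<partial>periodic_measure d \<theta> f (c j) (s j)) \<longlonglongrightarrow> L \<longrightarrow>
       (\<exists>\<mu>. accumulation_point d \<theta> f \<mu> \<and> L = (\<integral>x. g x \<partial>\<mu>))) \<and>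
    (\<forall>\<mu>. max_measures d f = {\<mu>} \<longrightarrow>
       (\<forall>g :: (nat \<Rightarrow> nat) \<Rightarrow> real. continuous_on (full_shift d) g \<longrightarrow>
          ((\<lambda>(c, s). \<integral>x. g x \<partial>periodic_measure d \<theta> f c s) \<longlongrightarrow> (\<integral>x. g x \<partial>\<mu>))
            (at_top \<times>\<^sub>F at_left 1)))"
proof -
  have "continuous_map (mtopology_of (shift_metric d \<theta>)) euclidean f"
    using Lipschitz_continuous_imp_continuous_map[OF lip] by simp
  then have cont: "continuous_on (full_shift d) f"
    by (simp add: mtopology_of_shift_metric[OF theta])
  obtain B where B: "\<And>x y. x \<in> full_shift d \<Longrightarrow> y \<in> full_shift d \<Longrightarrow>
      \<bar>f x - f y\<bar> \<le> B * theta_dist \<theta> x y"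
    using lip by (auto simp: Lipschitz_continuous_map_def shift_metric_simps[OF theta] dist_real_def)
  \<comment> \<open>The Lipschitz constant obtained above has no prescribed sign, while the
    distortion estimates multiply inequalities by it; hence the maximum with 0.\<close>
  interpret positive_lipschitz_potential d \<theta> f "max B 0"
  proof
    fix x y assume xy: "x \<in> full_shift d" "y \<in> full_shift d"
    have "B * theta_dist \<theta> x y \<le> max B 0 * theta_dist \<theta> x y"
      using theta by (intro mult_right_mono) (auto simp: theta_dist_def)
    then show "\<bar>f x - f y\<bar> \<le> max B 0 * theta_dist \<theta> x y"
      using B[OF xy] by linarith
  qed (use d theta cont pos in auto)
  show ?thesis
    using accumulation_point_maximizing limit_is_accumulation_integral tendsto_integral_of_unique_max
    by blast
qed

end
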